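(* Let $\mathcal W$ be a $2$-Weyl graph of type $M$. For every groupoid covering $\varphi:\mathcal G\to\overline{\mathcal W}$ of the fundamental groupoid of $\mathcal W$, there exists a covering of Weyl data $p:\widetilde{\mathcal W}\to\mathcal W$ such that the induced groupoid covering $\bar p:\overline{\widetilde{\mathcal W}}\to\overline{\mathcal W}$ is isomorphic to $\varphi$ as a covering of $\overline{\mathcal W}$.
   Context: Setting. $M=(m_{st})_{s,t\in S}$ is a Coxeter matrix on a finite set $S$, and $W=\langle S\mid (st)^{m_{st}}=1,\ m_{st}<\infty\rangle$ is its Coxeter group. A word over $S$ is reduced if no shorter word represents the same element of $W$. For $s\ne t$ let $p_m(s,t)=stst\cdots$ ($m$ letters), and if $m_{st}<\infty$ let $p(s,t)=p_{m_{st}}(s,t)$. Groupoids are small and non-empty, with composition $g;h$ (or $gh$) written left to right, defined when $\tau(g)=\iota(h)$, where $\iota,\tau$ denote initial and terminal vertices. Weyl data. A generalized chamber system $\mathcal W$ of type $M$ is a set $\mathcal W_0$ of chambers with a family of groupoids $(\mathcal W_s)_{s\in S}$ (panel groupoids), each with vertex set $\mathcal W_0$. An edge of $\mathcal W$ of type $s$ is a non-identity edge of $\mathcal W_s$ (edges of different types are distinct). An $s$-panel is a connected component of $\mathcal W_s$. A gallery $\beta$ is a finite sequence of consecutive edges (a trivial gallery is a single chamber with no edges), with initial chamber $\iota(\beta)$, terminal chamber $\tau(\beta)$, type $\beta_S$ (the word of types of its edges), and $W$-length $\beta_W\in W$ (the element represented by $\beta_S$). It is a cycle if $\iota(\beta)=\tau(\beta)$,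 and a geodesic if $\beta_S$ is reduced. For $s\neq t$ with $m_{st}<\infty$: an $(s,t)$-geodesic is a geodesic of type $p_m(s,t)$ for some $m$; a maximal $(s,t)$-geodesic is a gallery of type $p(s,t)$; an $(s,t)$-cycle is a cycle of type $p_{2m_{st}}(s,t)$. An alternating geodesic is an $(s,t)$-geodesic for some $s,t$; trivial galleries and one-edge galleries count as alternating geodesics. Weyl data of type $M$ is a generalized chamber system of type $M$ together with, for each ordered pair $(s,t)$ with $s\neq t$, $m_{st}<\infty$, a set of $(s,t)$-cycles called defining suites. Homotopy. Elementary homotopies of galleries are the following moves on subgalleries and their inverses: delete $i\,i^{-1}$; replace $i\,i'$ ($i,i'$ of the same type, $i'\ne i^{-1}$) by the single edge $i;i'$; delete a defining suite. Galleries are homotopic ($\sim$) if related by finitely many such moves. A suite is an $(s,t)$-cycle homotopic to a trivial gallery. The fundamental groupoid $\overline{\mathcal W}$ has vertices the chambers and edges the homotopy classes $[\beta]$ of galleries, with $[\beta];[\beta']=[\beta\beta']$. A morphism $\omega$ of Weyl data induces the groupoid homomorphism $\bar\omega:[\beta]\mapsto[\omega\circ\beta]$. Morphisms and coverings. A morphism of generalized chamber systems of type $M$ is a map on chambers and edges preserving extremities, types and inverses, with $\omega(i;i')=\omega(i);\omega(i')$ whenever $i,i'$ are composable of the same type and $i'\neq i^{-1}$. A morphism of Weyl data is such a morphism sending defining suites to suites. A morphism is surjective-étale if it is surjective on chambers and, for every chamber $C$, restricts to a bijection from the edges issuing from $C$ to the edges issuing from the image of $C$. A covering $p:\widetilde{\mathcal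 W}\to\mathcal W$ of Weyl data is a surjective-étale morphism of Weyl data such that every gallery $\beta$ of $\widetilde{\mathcal W}$ with $p\circ\beta$ a defining suite of $\mathcal W$ is a suite of $\widetilde{\mathcal W}$. A pre-Weyl graph is Weyl data satisfying (PW0) no panel is a trivial groupoid (one vertex, one edge), and (PW1) each maximal $(s,t)$-geodesic is homotopic to a maximal $(t,s)$-geodesic. A $2$-Weyl graph is a pre-Weyl graph satisfying (2W) homotopic alternating geodesics have the same $W$-length. A covering of groupoids is a surjective homomorphism $q:\widetilde{\mathcal G}\to\mathcal G$ such that for every vertex $\tilde x$ of $\widetilde{\mathcal G}$, $q$ restricts to a bijection from the edges issuing from $\tilde x$ to the edges issuing from $q(\tilde x)$. Two coverings $q_1:\mathcal G_1\to\mathcal G$, $q_2:\mathcal G_2\to\mathcal G$ are isomorphic if there is a groupoid isomorphism $\lambda:\mathcal G_1\to\mathcal G_2$ with $q_1=q_2\circ\lambda$. *)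

theory Defs
  imports "HOL-Library.Extended_Nat" "HOL-Algebra.Group"
begin

section \<open>Coxeter matrices and Coxeter groups\<close>

record 's coxeter =
  gens :: "'s set"
  mat :: "'s \<Rightarrow> 's \<Rightarrow> enat"

definition coxeter_matrix :: "'s coxeter \<Rightarrow> bool" where
  "coxeter_matrix M \<longleftrightarrow>
     finite (gens M) \<and>
     (\<forall>s\<in>gens M. mat M s s = 1) \<and>
     (\<forall>s\<in>gens M. \<forall>t\<in>gens M. mat M s t = mat M t s) \<and>
     (\<forall>s\<in>gens M. \<forall>t\<in>gens M. s \<noteq> t \<longrightarrow> 2 \<le> mat M s t)"

text \<open>The congruence on words generated by the relations \<open>(st)^m = 1\<close>, where \<open>m\<close> is the finite
  matrix entry of \<open>(s, t)\<close>. The case \<open>s = t\<close> gives \<open>ss = 1\<close>, so the presented monoid is already a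
  group and coincides with the group given by the same presentation.\<close>

inductive cox_cong :: "'s coxeter \<Rightarrow> 's list \<Rightarrow> 's list \<Rightarrow> bool" for M :: "'s coxeter" where
  rel: "\<lbrakk>s \<in> gens M; t \<in> gens M; mat M s t = enat m\<rbrakk>
    \<Longrightarrow> cox_cong M (concat (replicate m [s, t])) []"
| refl: "w \<in> lists (gens M) \<Longrightarrow> cox_cong M w w"
| sym: "cox_cong M u v \<Longrightarrow> cox_cong M v u"
| trans: "\<lbrakk>cox_cong M u v; cox_cong M v w\<rbrakk> \<Longrightarrow> cox_cong M u w"
| append: "\<lbrakk>cox_cong M u v; cox_cong M u' v'\<rbrakk> \<Longrightarrow> cox_cong M (u @ u') (v @ v')"

definition cox_elem :: "'s coxeter \<Rightarrow> 's list \<Rightarrow> 's list set" where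
  "cox_elem M w = {v. cox_cong M w v}"

definition coxeter_group :: "'s coxeter \<Rightarrow> 's list set monoid" where
  "coxeter_group M =
     \<lparr>carrier = cox_elem M ` lists (gens M),
      monoid.mult = (\<lambda>X Y. \<Union>u\<in>X. \<Union>v\<in>Y. cox_elem M (u @ v)),
      one = cox_elem M []\<rparr>"

definition reduced_word :: "'s coxeter \<Rightarrow> 's list \<Rightarrow> bool" where
  "reduced_word M w \<longleftrightarrow>
     w \<in> lists (gens M) \<and>
     (\<forall>v\<in>lists (gens M). cox_elem M v = cox_elem M w \<longrightarrow> length w \<le> length v)"

text \<open>The word \<open>stst\<dots>\<close> with \<open>n\<close> letters.\<close>

fun alt_word :: "nat \<Rightarrow> 's \<Rightarrow> 's \<Rightarrow> 's list" where
  "alt_word 0 s t = []"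
| "alt_word (Suc n) s t = s # alt_word n t s"

definition spherical_pair :: "'s coxeter \<Rightarrow> 's \<Rightarrow> 's \<Rightarrow> bool" where
  "spherical_pair M s t \<longleftrightarrow> s \<in> gens M \<and> t \<in> gens M \<and> s \<noteq> t \<and> mat M s t < \<infinity>"


section \<open>Groupoids and their coverings\<close>

text \<open>Composition \<open>seq G g h\<close> is written left to right.\<close>

record ('v, 'e) groupoid =
  verts :: "'v set"
  edges :: "'e set"
  iota :: "'e \<Rightarrow> 'v"
  tau :: "'e \<Rightarrow> 'v"
  seq :: "'e \<Rightarrow> 'e \<Rightarrow> 'e"
  ident :: "'v \<Rightarrow> 'e"
  inverse_edge :: "'e \<Rightarrow> 'e"

definition groupoid :: "('v, 'e) groupoid \<Rightarrow> bool" where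
  "groupoid G \<longleftrightarrow>
     verts G \<noteq> {} \<and>
     (\<forall>g\<in>edges G. iota G g \<in> verts G \<and> tau G g \<in> verts G) \<and>
     (\<forall>g\<in>edges G. \<forall>h\<in>edges G. tau G g = iota G h \<longrightarrow>
        seq G g h \<in> edges G \<and> iota G (seq G g h) = iota G g \<and> tau G (seq G g h) = tau G h) \<and>
     (\<forall>g\<in>edges G. \<forall>h\<in>edges G. \<forall>k\<in>edges G. tau G g = iota G h \<longrightarrow> tau G h = iota G k \<longrightarrow>
        seq G (seq G g h) k = seq G g (seq G h k)) \<and>
     (\<forall>x\<in>verts G. ident G x \<in> edges G \<and> iota G (ident G x) = x \<and> tau G (ident G x) = x) \<and>
     (\<forall>g\<in>edges G. seq G (ident G (iota G g)) g = g \<and> seq G g (ident G (tau G g)) = g) \<and>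
     (\<forall>g\<in>edges G. inverse_edge G g \<in> edges G \<and>
        iota G (inverse_edge G g) = tau G g \<and> tau G (inverse_edge G g) = iota G g \<and>
        seq G g (inverse_edge G g) = ident G (iota G g) \<and>
        seq G (inverse_edge G g) g = ident G (tau G g))"

text \<open>Connected components are taken as full subgroupoids.\<close>

definition component_of :: "('v, 'e) groupoid \<Rightarrow> 'v \<Rightarrow> 'v set" where
  "component_of G x = {y \<in> verts G. \<exists>g\<in>edges G. iota G g = x \<and> tau G g = y}"

definition connected_components :: "('v, 'e) groupoid \<Rightarrow> ('v, 'e) groupoid set" where
  "connected_components G =
     {G\<lparr>verts := component_of G x, edges := {g \<in> edges G. iota G g \<in> component_of G x}\<rparr> | x.
        x \<in> verts G}"

definition trivial_groupoid :: "('v, 'e) groupoid \<Rightarrow> bool" where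
  "trivial_groupoid G \<longleftrightarrow> (\<exists>x e. verts G = {x} \<and> edges G = {e})"

record ('v, 'e, 'w, 'f) graph_map =
  on_verts :: "'v \<Rightarrow> 'w"
  on_edges :: "'e \<Rightarrow> 'f"

definition groupoid_hom ::
    "('v, 'e, 'w, 'f) graph_map \<Rightarrow> ('v, 'e) groupoid \<Rightarrow> ('w, 'f) groupoid \<Rightarrow> bool" where
  "groupoid_hom q G H \<longleftrightarrow>
     groupoid G \<and> groupoid H \<and>
     (\<forall>x\<in>verts G. on_verts q x \<in> verts H) \<and>
     (\<forall>g\<in>edges G. on_edges q g \<in> edges H \<and>
        iota H (on_edges q g) = on_verts q (iota G g) \<and>
        tau H (on_edges q g) = on_verts q (tau G g)) \<and>
     (\<forall>g\<in>edges G. \<forall>h\<in>edges G. tau G g = iota G h \<longrightarrow>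
        on_edges q (seq G g h) = seq H (on_edges q g) (on_edges q h))"

definition groupoid_iso ::
    "('v, 'e, 'w, 'f) graph_map \<Rightarrow> ('v, 'e) groupoid \<Rightarrow> ('w, 'f) groupoid \<Rightarrow> bool" where
  "groupoid_iso q G H \<longleftrightarrow>
     groupoid_hom q G H \<and>
     bij_betw (on_verts q) (verts G) (verts H) \<and> bij_betw (on_edges q) (edges G) (edges H)"

definition groupoid_covering ::
    "('v, 'e, 'w, 'f) graph_map \<Rightarrow> ('v, 'e) groupoid \<Rightarrow> ('w, 'f) groupoid \<Rightarrow> bool" where
  "groupoid_covering q G H \<longleftrightarrow>
     groupoid_hom q G H \<and>
     on_verts q ` verts G = verts H \<and> on_edges q ` edges G = edges H \<and>
     (\<forall>x\<in>verts G. bij_betw (on_edges q)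
        {g \<in> edges G. iota G g = x} {h \<in> edges H. iota H h = on_verts q x})"

definition isomorphic_coverings ::
    "('v, 'e, 'w, 'f) graph_map \<Rightarrow> ('v, 'e) groupoid \<Rightarrow>
     ('x, 'g, 'w, 'f) graph_map \<Rightarrow> ('x, 'g) groupoid \<Rightarrow> ('w, 'f) groupoid \<Rightarrow> bool" where
  "isomorphic_coverings q1 G1 q2 G2 H \<longleftrightarrow>
     groupoid_covering q1 G1 H \<and> groupoid_covering q2 G2 H \<and>
     (\<exists>l. groupoid_iso l G1 G2 \<and>
        (\<forall>x\<in>verts G1. on_verts q1 x = on_verts q2 (on_verts l x)) \<and>
        (\<forall>g\<in>edges G1. on_edges q1 g = on_edges q2 (on_edges l g)))"


section \<open>Generalized chamber systems and Weyl data\<close>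

record ('s, 'c, 'e) chamber_system =
  chambers :: "'c set"
  panel_groupoid :: "'s \<Rightarrow> ('c, 'e) groupoid"

text \<open>For a nonempty set of generators, nonemptiness of the set of chambers follows from that of
  the panel groupoids; it is only an additional requirement if there are no generators.\<close>

definition chamber_system ::
    "'s coxeter \<Rightarrow> ('s, 'c, 'e, 'z) chamber_system_scheme \<Rightarrow> bool" where
  "chamber_system M W \<longleftrightarrow>
     chambers W \<noteq> {} \<and>
     (\<forall>s\<in>gens M. groupoid (panel_groupoid W s) \<and> verts (panel_groupoid W s) = chambers W)"

text \<open>An edge carries its type as first component, which makes edges of different types distinct.\<close>

definition typed_edges ::
    "'s coxeter \<Rightarrow> ('s, 'c, 'e, 'z) chamber_system_scheme \<Rightarrow> ('s \<times> 'e) set" where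
  "typed_edges M W =
     {(s, e). s \<in> gens M \<and> e \<in> edges (panel_groupoid W s) \<and>
        e \<notin> ident (panel_groupoid W s) ` chambers W}"

definition eiota :: "('s, 'c, 'e, 'z) chamber_system_scheme \<Rightarrow> 's \<times> 'e \<Rightarrow> 'c" where
  "eiota W i = iota (panel_groupoid W (fst i)) (snd i)"

definition etau :: "('s, 'c, 'e, 'z) chamber_system_scheme \<Rightarrow> 's \<times> 'e \<Rightarrow> 'c" where
  "etau W i = tau (panel_groupoid W (fst i)) (snd i)"

definition einv :: "('s, 'c, 'e, 'z) chamber_system_scheme \<Rightarrow> 's \<times> 'e \<Rightarrow> 's \<times> 'e" where
  "einv W i = (fst i, inverse_edge (panel_groupoid W (fst i)) (snd i))"

text \<open>Only meaningful for edges of the same type.\<close>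

definition eseq ::
    "('s, 'c, 'e, 'z) chamber_system_scheme \<Rightarrow> 's \<times> 'e \<Rightarrow> 's \<times> 'e \<Rightarrow> 's \<times> 'e" where
  "eseq W i j = (fst i, seq (panel_groupoid W (fst i)) (snd i) (snd j))"

text \<open>A gallery is its initial chamber together with its list of edges.\<close>

type_synonym ('s, 'c, 'e) gallery = "'c \<times> ('s \<times> 'e) list"

fun consecutive ::
    "('s, 'c, 'e, 'z) chamber_system_scheme \<Rightarrow> 'c \<Rightarrow> ('s \<times> 'e) list \<Rightarrow> bool" where
  "consecutive W C [] \<longleftrightarrow> True"
| "consecutive W C (i # is) \<longleftrightarrow> eiota W i = C \<and> consecutive W (etau W i) is"

definition gallery ::
    "'s coxeter \<Rightarrow> ('s, 'c, 'e, 'z) chamber_system_scheme \<Rightarrow> ('s, 'c, 'e) gallery \<Rightarrow> bool" where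
  "gallery M W b \<longleftrightarrow>
     fst b \<in> chambers W \<and> set (snd b) \<subseteq> typed_edges M W \<and> consecutive W (fst b) (snd b)"

definition giota :: "('s, 'c, 'e) gallery \<Rightarrow> 'c" where
  "giota b = fst b"

definition gtau ::
    "('s, 'c, 'e, 'z) chamber_system_scheme \<Rightarrow> ('s, 'c, 'e) gallery \<Rightarrow> 'c" where
  "gtau W b = (if snd b = [] then fst b else etau W (last (snd b)))"

definition gtype :: "('s, 'c, 'e) gallery \<Rightarrow> 's list" where
  "gtype b = map fst (snd b)"

definition W_length :: "'s coxeter \<Rightarrow> ('s, 'c, 'e) gallery \<Rightarrow> 's list set" where
  "W_length M b = cox_elem M (gtype b)"

definition gappend ::
    "('s, 'c, 'e) gallery \<Rightarrow> ('s, 'c, 'e) gallery \<Rightarrow> ('s, 'c, 'e) gallery" where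
  "gappend b b' = (fst b, snd b @ snd b')"

definition greverse ::
    "('s, 'c, 'e, 'z) chamber_system_scheme \<Rightarrow> ('s, 'c, 'e) gallery \<Rightarrow> ('s, 'c, 'e) gallery" where
  "greverse W b = (gtau W b, rev (map (einv W) (snd b)))"

definition geodesic ::
    "'s coxeter \<Rightarrow> ('s, 'c, 'e, 'z) chamber_system_scheme \<Rightarrow> ('s, 'c, 'e) gallery \<Rightarrow> bool" where
  "geodesic M W b \<longleftrightarrow> gallery M W b \<and> reduced_word M (gtype b)"

definition st_geodesic ::
    "'s coxeter \<Rightarrow> ('s, 'c, 'e, 'z) chamber_system_scheme \<Rightarrow> 's \<Rightarrow> 's \<Rightarrow>
     ('s, 'c, 'e) gallery \<Rightarrow> bool" where
  "st_geodesic M W s t b \<longleftrightarrow>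
     spherical_pair M s t \<and> geodesic M W b \<and> (\<exists>n. gtype b = alt_word n s t)"

definition maximal_st_geodesic ::
    "'s coxeter \<Rightarrow> ('s, 'c, 'e, 'z) chamber_system_scheme \<Rightarrow> 's \<Rightarrow> 's \<Rightarrow>
     ('s, 'c, 'e) gallery \<Rightarrow> bool" where
  "maximal_st_geodesic M W s t b \<longleftrightarrow>
     spherical_pair M s t \<and> gallery M W b \<and> gtype b = alt_word (the_enat (mat M s t)) s t"

definition st_cycle ::
    "'s coxeter \<Rightarrow> ('s, 'c, 'e, 'z) chamber_system_scheme \<Rightarrow> 's \<Rightarrow> 's \<Rightarrow>
     ('s, 'c, 'e) gallery \<Rightarrow> bool" where
  "st_cycle M W s t b \<longleftrightarrow>
     spherical_pair M s t \<and> gallery M W b \<and> giota b = gtau W b \<and>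
     gtype b = alt_word (2 * the_enat (mat M s t)) s t"

definition alternating_geodesic ::
    "'s coxeter \<Rightarrow> ('s, 'c, 'e, 'z) chamber_system_scheme \<Rightarrow> ('s, 'c, 'e) gallery \<Rightarrow> bool" where
  "alternating_geodesic M W b \<longleftrightarrow>
     (\<exists>s t. st_geodesic M W s t b) \<or> (gallery M W b \<and> length (snd b) \<le> 1)"

record ('s, 'c, 'e) weyl_data = "('s, 'c, 'e) chamber_system" +
  def_suites :: "'s \<Rightarrow> 's \<Rightarrow> ('s, 'c, 'e) gallery set"

definition weyl_data :: "'s coxeter \<Rightarrow> ('s, 'c, 'e) weyl_data \<Rightarrow> bool" where
  "weyl_data M W \<longleftrightarrow>
     coxeter_matrix M \<and> chamber_system M W \<and>
     (\<forall>s t. spherical_pair M s t \<longrightarrow> (\<forall>b\<in>def_suites W s t. st_cycle M W s t b))"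

definition defining_suite ::
    "'s coxeter \<Rightarrow> ('s, 'c, 'e) weyl_data \<Rightarrow> ('s, 'c, 'e) gallery \<Rightarrow> bool" where
  "defining_suite M W b \<longleftrightarrow> (\<exists>s t. spherical_pair M s t \<and> b \<in> def_suites W s t)"


section \<open>Homotopy and the fundamental groupoid\<close>

inductive elementary_homotopy ::
    "'s coxeter \<Rightarrow> ('s, 'c, 'e) weyl_data \<Rightarrow>
     ('s, 'c, 'e) gallery \<Rightarrow> ('s, 'c, 'e) gallery \<Rightarrow> bool"
  for M :: "'s coxeter" and W :: "('s, 'c, 'e) weyl_data" where
  cancel: "gallery M W (C, xs @ [i, einv W i] @ ys)
    \<Longrightarrow> elementary_homotopy M W (C, xs @ [i, einv W i] @ ys) (C, xs @ ys)"
| compose: "\<lbrakk>gallery M W (C, xs @ [i, i'] @ ys); fst i = fst i'; i' \<noteq> einv W i\<rbrakk>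
    \<Longrightarrow> elementary_homotopy M W (C, xs @ [i, i'] @ ys) (C, xs @ [eseq W i i'] @ ys)"
| suite: "\<lbrakk>gallery M W (C, xs @ us @ ys); defining_suite M W (gtau W (C, xs), us)\<rbrakk>
    \<Longrightarrow> elementary_homotopy M W (C, xs @ us @ ys) (C, xs @ ys)"

definition homotopic ::
    "'s coxeter \<Rightarrow> ('s, 'c, 'e) weyl_data \<Rightarrow>
     ('s, 'c, 'e) gallery \<Rightarrow> ('s, 'c, 'e) gallery \<Rightarrow> bool" where
  "homotopic M W b b' \<longleftrightarrow>
     gallery M W b \<and> gallery M W b' \<and> equivclp (elementary_homotopy M W) b b'"

definition suite_gallery ::
    "'s coxeter \<Rightarrow> ('s, 'c, 'e) weyl_data \<Rightarrow> ('s, 'c, 'e) gallery \<Rightarrow> bool" where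
  "suite_gallery M W b \<longleftrightarrow> (\<exists>s t. st_cycle M W s t b) \<and> (\<exists>C. homotopic M W b (C, []))"

definition hclass ::
    "'s coxeter \<Rightarrow> ('s, 'c, 'e) weyl_data \<Rightarrow>
     ('s, 'c, 'e) gallery \<Rightarrow> ('s, 'c, 'e) gallery set" where
  "hclass M W b = {b'. homotopic M W b b'}"

definition fundamental_groupoid ::
    "'s coxeter \<Rightarrow> ('s, 'c, 'e) weyl_data \<Rightarrow> ('c, ('s, 'c, 'e) gallery set) groupoid" where
  "fundamental_groupoid M W =
     \<lparr>verts = chambers W,
      edges = hclass M W ` {b. gallery M W b},
      iota = (\<lambda>X. the_elem (giota ` X)),
      tau = (\<lambda>X. the_elem (gtau W ` X)),
      seq = (\<lambda>X Y. \<Union>b\<in>X. \<Union>b'\<in>Y. hclass M W (gappend b b')),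
      ident = (\<lambda>C. hclass M W (C, [])),
      inverse_edge = (\<lambda>X. \<Union>b\<in>X. hclass M W (greverse W b))\<rparr>"


section \<open>Pre-Weyl graphs and 2-Weyl graphs\<close>

definition pre_weyl_graph :: "'s coxeter \<Rightarrow> ('s, 'c, 'e) weyl_data \<Rightarrow> bool" where
  "pre_weyl_graph M W \<longleftrightarrow>
     weyl_data M W \<and>
     (\<forall>s\<in>gens M. \<forall>P\<in>connected_components (panel_groupoid W s). \<not> trivial_groupoid P) \<and>
     (\<forall>s t b. maximal_st_geodesic M W s t b \<longrightarrow>
        (\<exists>b'. maximal_st_geodesic M W t s b' \<and> homotopic M W b b'))"

definition two_weyl_graph :: "'s coxeter \<Rightarrow> ('s, 'c, 'e) weyl_data \<Rightarrow> bool" where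
  "two_weyl_graph M W \<longleftrightarrow>
     pre_weyl_graph M W \<and>
     (\<forall>b b'. alternating_geodesic M W b \<longrightarrow> alternating_geodesic M W b' \<longrightarrow>
        homotopic M W b b' \<longrightarrow> W_length M b = W_length M b')"


section \<open>Morphisms and coverings of Weyl data\<close>

definition chamber_system_morphism ::
    "'s coxeter \<Rightarrow> ('c, 's \<times> 'e, 'd, 's \<times> 'f) graph_map \<Rightarrow>
     ('s, 'c, 'e, 'y) chamber_system_scheme \<Rightarrow> ('s, 'd, 'f, 'z) chamber_system_scheme \<Rightarrow> bool" where
  "chamber_system_morphism M p V W \<longleftrightarrow>
     chamber_system M V \<and> chamber_system M W \<and>
     (\<forall>C\<in>chambers V. on_verts p C \<in> chambers W) \<and>
     (\<forall>i\<in>typed_edges M V. on_edges p i \<in> typed_edges M W \<and>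
        eiota W (on_edges p i) = on_verts p (eiota V i) \<and>
        etau W (on_edges p i) = on_verts p (etau V i) \<and>
        fst (on_edges p i) = fst i \<and>
        on_edges p (einv V i) = einv W (on_edges p i)) \<and>
     (\<forall>i\<in>typed_edges M V. \<forall>i'\<in>typed_edges M V.
        fst i = fst i' \<longrightarrow> etau V i = eiota V i' \<longrightarrow> i' \<noteq> einv V i \<longrightarrow>
        on_edges p (eseq V i i') = eseq W (on_edges p i) (on_edges p i'))"

definition map_gallery ::
    "('c, 's \<times> 'e, 'd, 's \<times> 'f) graph_map \<Rightarrow> ('s, 'c, 'e) gallery \<Rightarrow> ('s, 'd, 'f) gallery" where
  "map_gallery p b = (on_verts p (fst b), map (on_edges p) (snd b))"

definition weyl_morphism ::
    "'s coxeter \<Rightarrow> ('c, 's \<times> 'e, 'd, 's \<times> 'f) graph_map \<Rightarrow>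
     ('s, 'c, 'e) weyl_data \<Rightarrow> ('s, 'd, 'f) weyl_data \<Rightarrow> bool" where
  "weyl_morphism M p V W \<longleftrightarrow>
     weyl_data M V \<and> weyl_data M W \<and> chamber_system_morphism M p V W \<and>
     (\<forall>b. defining_suite M V b \<longrightarrow> suite_gallery M W (map_gallery p b))"

definition surjective_etale ::
    "'s coxeter \<Rightarrow> ('c, 's \<times> 'e, 'd, 's \<times> 'f) graph_map \<Rightarrow>
     ('s, 'c, 'e, 'y) chamber_system_scheme \<Rightarrow> ('s, 'd, 'f, 'z) chamber_system_scheme \<Rightarrow> bool" where
  "surjective_etale M p V W \<longleftrightarrow>
     on_verts p ` chambers V = chambers W \<and>
     (\<forall>C\<in>chambers V. bij_betw (on_edges p)
        {i \<in> typed_edges M V. eiota V i = C} {j \<in> typed_edges M W. eiota W j = on_verts p C})"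

definition weyl_covering ::
    "'s coxeter \<Rightarrow> ('c, 's \<times> 'e, 'd, 's \<times> 'f) graph_map \<Rightarrow>
     ('s, 'c, 'e) weyl_data \<Rightarrow> ('s, 'd, 'f) weyl_data \<Rightarrow> bool" where
  "weyl_covering M p V W \<longleftrightarrow>
     weyl_morphism M p V W \<and> surjective_etale M p V W \<and>
     (\<forall>b. gallery M V b \<longrightarrow> defining_suite M W (map_gallery p b) \<longrightarrow> suite_gallery M V b)"

text \<open>The homomorphism induced on fundamental groupoids by a morphism of Weyl data with target
  \<open>W\<close>.\<close>

definition induced_hom ::
    "'s coxeter \<Rightarrow> ('s, 'd, 'f) weyl_data \<Rightarrow> ('c, 's \<times> 'e, 'd, 's \<times> 'f) graph_map \<Rightarrow>
     ('c, ('s, 'c, 'e) gallery set, 'd, ('s, 'd, 'f) gallery set) graph_map" where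
  "induced_hom M W p =
     \<lparr>on_verts = on_verts p,
      on_edges = (\<lambda>X. \<Union>b\<in>X. hclass M W (map_gallery p b))\<rparr>"

end

theory Submission
  imports Defs
begin

text \<open>The chambers of the covering are the vertices of the total groupoid \<open>G\<close>. An \<open>s\<close>-edge from \<open>x\<close> is
  a pair \<open>(x, e)\<close> with \<open>e\<close> an edge of the \<open>s\<close>-panel groupoid issuing from the image of \<open>x\<close>; it ends
  where the lift of the homotopy class of \<open>e\<close> to \<open>G\<close> starting at \<open>x\<close> ends. The defining suites are
  all galleries lying over defining suites; they are closed because a suite is null-homotopic, so its
  class lifts to an identity. Galleries and elementary homotopies then lift uniquely along the
  projection, so the induced homomorphism of fundamental groupoids is a covering. By construction a
  gallery from \<open>x\<close> ends where the \<open>G\<close>-lift of its projected class ends, so lifting identifies it with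
  the given covering. The label \<open>e\<close> keeps distinct panel edges apart even when they are homotopic.\<close>

section \<open>Groupoids and unique lifting\<close>

text \<open>The clauses are cited by position: 2-3 extremities, 4-6 composites, 7 associativity,
  8-10 identities, 11-12 unit laws, 13-17 inverses.\<close>

lemma groupoidD:
  assumes "groupoid G"
  shows "verts G \<noteq> {}"
    and "g \<in> edges G \<Longrightarrow> iota G g \<in> verts G"
    and "g \<in> edges G \<Longrightarrow> tau G g \<in> verts G"
    and "\<lbrakk>g \<in> edges G; h \<in> edges G; tau G g = iota G h\<rbrakk> \<Longrightarrow> seq G g h \<in> edges G"
    and "\<lbrakk>g \<in> edges G; h \<in> edges G; tau G g = iota G h\<rbrakk> \<Longrightarrow> iota G (seq G g h) = iota G g"
    and "\<lbrakk>g \<in> edges G; h \<in> edges G; tau G g = iota G h\<rbrakk> \<Longrightarrow> tau G (seq G g h) = tau G h"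
    and "\<lbrakk>g \<in> edges G; h \<in> edges G; k \<in> edges G; tau G g = iota G h; tau G h = iota G k\<rbrakk>
      \<Longrightarrow> seq G (seq G g h) k = seq G g (seq G h k)"
    and "x \<in> verts G \<Longrightarrow> ident G x \<in> edges G"
    and "x \<in> verts G \<Longrightarrow> iota G (ident G x) = x"
    and "x \<in> verts G \<Longrightarrow> tau G (ident G x) = x"
    and "g \<in> edges G \<Longrightarrow> seq G (ident G (iota G g)) g = g"
    and "g \<in> edges G \<Longrightarrow> seq G g (ident G (tau G g)) = g"
    and "g \<in> edges G \<Longrightarrow> inverse_edge G g \<in> edges G"
    and "g \<in> edges G \<Longrightarrow> iota G (inverse_edge G g) = tau G g"
    and "g \<in> edges G \<Longrightarrow> tau G (inverse_edge G g) = iota G g"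
    and "g \<in> edges G \<Longrightarrow> seq G g (inverse_edge G g) = ident G (iota G g)"
    and "g \<in> edges G \<Longrightarrow> seq G (inverse_edge G g) g = ident G (tau G g)"
  using assms unfolding groupoid_def by simp_all

text \<open>Cancelling one factor of \<open>g;g = g\<close> with the inverse of \<open>g\<close>
  leaves an identity. As \<open>groupoid_hom\<close> only asks for compatibility with extremities
  and composites, this is what makes homomorphisms preserve identities.\<close>

lemma groupoid_idempotent:
  assumes G: "groupoid G" and g: "g \<in> edges G" and "tau G g = iota G g" "seq G g g = g"
  shows "g = ident G (iota G g)"
proof -
  have "ident G (iota G g) = seq G (seq G g g) (inverse_edge G g)"
    using groupoidD(16)[OF G g] assms(4) by simp
  also have "\<dots> = seq G g (seq G g (inverse_edge G g))"
    by (rule groupoidD(7)[OF G]) (use assms groupoidD[OF G] in auto)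
  also have "\<dots> = g" using groupoidD(12,16)[OF G g] assms(3) by simp
  finally show ?thesis ..
qed

lemma groupoid_inverse_unique:
  assumes G: "groupoid G" and g: "g \<in> edges G" and h: "h \<in> edges G"
    and "tau G g = iota G h" "seq G g h = ident G (iota G g)"
  shows "h = inverse_edge G g"
proof -
  have "h = seq G (seq G (inverse_edge G g) g) h"
    using groupoidD(11)[OF G h] groupoidD(17)[OF G g] assms(4) by simp
  also have "\<dots> = seq G (inverse_edge G g) (seq G g h)"
    by (rule groupoidD(7)[OF G]) (use assms groupoidD[OF G] in auto)
  also have "\<dots> = inverse_edge G g"
    using groupoidD(12)[OF G groupoidD(13)[OF G g]] groupoidD(15)[OF G g] assms(5) by simp
  finally show ?thesis .
qed

lemma groupoid_inverse_inverse:
  assumes "groupoid G" "g \<in> edges G"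
  shows "inverse_edge G (inverse_edge G g) = g"
  by (rule groupoid_inverse_unique[symmetric]) (use assms groupoidD[OF assms(1)] in auto)

lemma groupoid_inverse_ident:
  assumes G: "groupoid G" and x: "x \<in> verts G"
  shows "inverse_edge G (ident G x) = ident G x"
  by (rule groupoid_inverse_unique[symmetric])
    (use assms groupoidD[OF G] groupoidD(11)[OF G groupoidD(8)[OF G x]] in auto)

lemma groupoid_hom_ident:
  assumes q: "groupoid_hom q G H" and x: "x \<in> verts G"
  shows "on_edges q (ident G x) = ident H (on_verts q x)"
proof -
  have G: "groupoid G" and H: "groupoid H" using q by (auto simp: groupoid_hom_def)
  have i: "ident G x \<in> edges G" "iota G (ident G x) = x" "tau G (ident G x) = x"
    using groupoidD[OF G] x by auto
  have "seq G (ident G x) (ident G x) = ident G x"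
    using groupoidD(11)[OF G i(1)] i by simp
  then have "seq H (on_edges q (ident G x)) (on_edges q (ident G x)) = on_edges q (ident G x)"
    using q i unfolding groupoid_hom_def by metis
  moreover have "on_edges q (ident G x) \<in> edges H"
    "iota H (on_edges q (ident G x)) = on_verts q x" "tau H (on_edges q (ident G x)) = on_verts q x"
    using q i unfolding groupoid_hom_def by metis+
  ultimately show ?thesis using groupoid_idempotent[OF H] by metis
qed

section \<open>Lifts, fibre transport and isomorphism of groupoid coverings\<close>

locale groupoid_cov =
  fixes q :: "('v, 'e, 'w, 'f) graph_map" and G :: "('v, 'e) groupoid" and H :: "('w, 'f) groupoid"
  assumes covering: "groupoid_covering q G H"
begin

lemma hom: "groupoid_hom q G H"
  using covering by (simp add: groupoid_covering_def)

lemma groupoid_total: "groupoid G"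
  using hom by (simp add: groupoid_hom_def)

lemma homD:
  "x \<in> verts G \<Longrightarrow> on_verts q x \<in> verts H"
  "g \<in> edges G \<Longrightarrow> on_edges q g \<in> edges H"
  "g \<in> edges G \<Longrightarrow> iota H (on_edges q g) = on_verts q (iota G g)"
  "g \<in> edges G \<Longrightarrow> tau H (on_edges q g) = on_verts q (tau G g)"
  "\<lbrakk>g \<in> edges G; h \<in> edges G; tau G g = iota G h\<rbrakk>
    \<Longrightarrow> on_edges q (seq G g h) = seq H (on_edges q g) (on_edges q h)"
  using hom by (simp_all add: groupoid_hom_def)

lemma star_bij:
  "x \<in> verts G \<Longrightarrow>
     bij_betw (on_edges q) {g \<in> edges G. iota G g = x} {h \<in> edges H. iota H h = on_verts q x}"
  using covering by (simp add: groupoid_covering_def)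

text \<open>The description denotes an edge only when \<open>x\<close> is a vertex and
  \<open>h\<close> an edge issuing from its image; bijectivity on stars then gives existence and
  uniqueness.\<close>

definition lift :: "'v \<Rightarrow> 'f \<Rightarrow> 'e" where
  "lift x h = (THE g. g \<in> edges G \<and> iota G g = x \<and> on_edges q g = h)"

text \<open>Fibre transport (monodromy): the edges of \<open>H\<close> act on the fibres of
  \<open>q\<close>, carrying the fibre over \<open>iota H h\<close> to the fibre over
  \<open>tau H h\<close>.\<close>

definition endpoint :: "'v \<Rightarrow> 'f \<Rightarrow> 'v" where
  "endpoint x h = tau G (lift x h)"

lemma lift_unique:
  assumes "g \<in> edges G"
  shows "lift (iota G g) (on_edges q g) = g"
  unfolding lift_def
proof (rule the_equality)
  fix g' assume g': "g' \<in> edges G \<and> iota G g' = iota G g \<and> on_edges q g' = on_edges q g"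
  have "inj_on (on_edges q) {k \<in> edges G. iota G k = iota G g}"
    using star_bij[of "iota G g"] groupoidD(2)[OF groupoid_total assms] by (simp add: bij_betw_def)
  then show "g' = g" using g' assms by (auto dest: inj_onD)
qed (use assms in simp)

lemma lift:
  assumes "x \<in> verts G" "h \<in> edges H" "iota H h = on_verts q x"
  shows lift_edge: "lift x h \<in> edges G" and iota_lift: "iota G (lift x h) = x"
    and project_lift: "on_edges q (lift x h) = h"
proof -
  have "h \<in> on_edges q ` {g \<in> edges G. iota G g = x}"
    using star_bij[of x] assms by (auto simp: bij_betw_def)
  then obtain g where "g \<in> edges G" "iota G g = x" "on_edges q g = h" by auto
  with lift_unique[of g]
  show "lift x h \<in> edges G" "iota G (lift x h) = x" "on_edges q (lift x h) = h" by auto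
qed

lemma endpoint:
  assumes "x \<in> verts G" "h \<in> edges H" "iota H h = on_verts q x"
  shows endpoint_vert: "endpoint x h \<in> verts G"
    and project_endpoint: "on_verts q (endpoint x h) = tau H h"
  using lift[OF assms] groupoidD(3)[OF groupoid_total] homD(4)[of "lift x h"]
  by (auto simp: endpoint_def)

text \<open>Lifts compose: lifting \<open>h\<close> at \<open>x\<close> and then \<open>k\<close> at
  the end reached gives an edge over \<open>seq H h k\<close> starting at \<open>x\<close>, hence
  its lift by uniqueness. Transport along a gallery can thus be computed one edge at a time.\<close>

lemma endpoint_seq:
  assumes "x \<in> verts G" "h \<in> edges H" "iota H h = on_verts q x" "k \<in> edges H" "tau H h = iota H k"
  shows "endpoint x (seq H h k) = endpoint (endpoint x h) k"
proof -
  let ?g = "lift x h" let ?k = "lift (endpoint x h) k"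
  note g = lift[OF assms(1-3)]
  have k: "?k \<in> edges G" "iota G ?k = tau G ?g" "on_edges q ?k = k"
    using lift[OF endpoint_vert[OF assms(1-3)] assms(4)] project_endpoint[OF assms(1-3)] assms(5)
    by (auto simp: endpoint_def)
  note s = groupoidD(4-6)[OF groupoid_total g(1) k(1) k(2)[symmetric]]
  have "lift x (seq H h k) = seq G ?g ?k"
    using lift_unique[OF s(1)] s(2) homD(5)[OF g(1) k(1) k(2)[symmetric]] g k by simp
  then show ?thesis using s(3) by (simp add: endpoint_def)
qed

lemma endpoint_ident:
  assumes "x \<in> verts G"
  shows "endpoint x (ident H (on_verts q x)) = x"
  using lift_unique[OF groupoidD(8)[OF groupoid_total assms]] groupoid_hom_ident[OF hom assms]
    groupoidD(9,10)[OF groupoid_total assms] by (simp add: endpoint_def)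

text \<open>An edge of a covering is determined by its start and its image, so only one candidate
  for the isomorphism fixes all vertices: lift the image of each edge to \<open>G\<close> at the
  same start. The premise \<open>tau\<close> says that the ends match as well; unique lifting yields
  the rest.\<close>

lemma isomorphicI:
  assumes q1: "groupoid_covering q1 G1 H" and verts: "verts G1 = verts G"
    and on_verts: "\<And>x. x \<in> verts G \<Longrightarrow> on_verts q1 x = on_verts q x"
    and tau: "\<And>g. g \<in> edges G1 \<Longrightarrow> endpoint (iota G1 g) (on_edges q1 g) = tau G1 g"
  shows "isomorphic_coverings q1 G1 q G H"
proof -
  interpret C: groupoid_cov q1 G1 H using q1 by unfold_locales
  define l where
    "l = \<lparr>on_verts = (\<lambda>x::'v. x), on_edges = (\<lambda>g. lift (iota G1 g) (on_edges q1 g))\<rparr>"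
  have lv: "on_verts l x = x" for x by (simp add: l_def)
  have l: "on_edges l g \<in> edges G" "iota G (on_edges l g) = iota G1 g"
    "on_edges q (on_edges l g) = on_edges q1 g" "tau G (on_edges l g) = tau G1 g"
    if g: "g \<in> edges G1" for g
  proof -
    have x: "iota G1 g \<in> verts G" using groupoidD(2)[OF C.groupoid_total g] verts by simp
    have "iota H (on_edges q1 g) = on_verts q (iota G1 g)" using C.homD(3)[OF g] on_verts[OF x] by simp
    note L = lift[OF x C.homD(2)[OF g] this]
    show "on_edges l g \<in> edges G" "iota G (on_edges l g) = iota G1 g"
      "on_edges q (on_edges l g) = on_edges q1 g" "tau G (on_edges l g) = tau G1 g"
      using L tau[OF g] by (auto simp: l_def endpoint_def)
  qed
  have "on_edges l (seq G1 g h) = seq G (on_edges l g) (on_edges l h)"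
    if g: "g \<in> edges G1" and h: "h \<in> edges G1" and gh: "tau G1 g = iota G1 h" for g h
  proof -
    have c: "tau G (on_edges l g) = iota G (on_edges l h)" using l g h gh by simp
    let ?k = "seq G (on_edges l g) (on_edges l h)"
    have k: "?k \<in> edges G" "iota G ?k = iota G1 g"
      using groupoidD(4,5)[OF groupoid_total l(1)[OF g] l(1)[OF h] c] l(2)[OF g] by auto
    \<comment> \<open>\<open>?k\<close> and the image of \<open>seq G1 g h\<close> under
      \<open>l\<close> have the same start; once their images under \<open>q\<close> agree,
      uniqueness of lifts identifies them.\<close>
    have "on_edges q ?k = on_edges q1 (seq G1 g h)"
      using homD(5)[OF l(1)[OF g] l(1)[OF h] c] C.homD(5)[OF g h gh] l(3) g h by simp
    then show ?thesis
      using lift_unique[OF k(1)] k(2) groupoidD(5)[OF C.groupoid_total g h gh] by (simp add: l_def)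
  qed
  then have "groupoid_hom l G1 G"
    using l groupoidD(2,3)[OF C.groupoid_total] groupoid_total C.groupoid_total verts
    by (simp add: groupoid_hom_def lv)
  moreover have "bij_betw (on_verts l) (verts G1) (verts G)"
    using verts by (simp add: l_def bij_betw_def)
  moreover have "bij_betw (on_edges l) (edges G1) (edges G)"
  proof (rule bij_betwI')
    fix g h assume gh: "g \<in> edges G1" "h \<in> edges G1"
    show "(on_edges l g = on_edges l h) = (g = h)"
    proof
      assume "on_edges l g = on_edges l h"
      then have "iota G1 g = iota G1 h" "on_edges q1 g = on_edges q1 h" using l gh by metis+
      then show "g = h" using C.lift_unique gh by metis
    qed simp
  next
    fix g assume g: "g \<in> edges G"
    then have x: "iota G g \<in> verts G1" using verts groupoidD(2)[OF groupoid_total] by simp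
    have "iota H (on_edges q g) = on_verts q1 (iota G g)" using homD(3)[OF g] on_verts x verts by simp
    \<comment> \<open>The preimage of \<open>g\<close> is the lift to \<open>G1\<close> of the image
      of \<open>g\<close>; lifting the image of that edge back to \<open>G\<close> returns
      \<open>g\<close>.\<close>
    from C.lift[OF x homD(2)[OF g] this] lift_unique[OF g]
    show "\<exists>k\<in>edges G1. g = on_edges l k"
      by (intro bexI[of _ "C.lift (iota G g) (on_edges q g)"]) (auto simp: l_def)
  qed (use l in simp)
  ultimately have "groupoid_iso l G1 G" by (simp add: groupoid_iso_def)
  then show ?thesis
    using q1 covering l(3) on_verts verts unfolding isomorphic_coverings_def
    by (intro conjI exI[of _ l]) (simp_all add: lv)
qed

end


section \<open>Homotopy of galleries\<close>

lemma consecutive_append: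
  "consecutive W C (xs @ ys) \<longleftrightarrow> consecutive W C xs \<and> consecutive W (gtau W (C, xs)) ys"
  by (induction xs arbitrary: C) (auto simp: gtau_def)

lemma gtau_Nil [simp]: "gtau W (C, []) = C"
  by (simp add: gtau_def)

lemma gtau_Cons [simp]: "gtau W (C, i # is) = gtau W (etau W i, is)"
  by (simp add: gtau_def)

lemma gtau_append [simp]: "gtau W (C, xs @ ys) = gtau W (gtau W (C, xs), ys)"
  by (auto simp: gtau_def)

section \<open>Edges and galleries of Weyl data\<close>

locale weyl =
  fixes M :: "'s coxeter" and W :: "('s, 'c, 'e) weyl_data"
  assumes weyl_data: "weyl_data M W"
begin

lemma panel: "s \<in> gens M \<Longrightarrow> groupoid (panel_groupoid W s)"
  and verts_panel: "s \<in> gens M \<Longrightarrow> verts (panel_groupoid W s) = chambers W"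
  using weyl_data by (auto simp: weyl_data_def chamber_system_def)

lemma typed_edgeD:
  assumes "i \<in> typed_edges M W"
  shows eiota_chamber: "eiota W i \<in> chambers W" and etau_chamber: "etau W i \<in> chambers W"
    and einv_edge: "einv W i \<in> typed_edges M W"
    and eiota_einv: "eiota W (einv W i) = etau W i"
    and etau_einv: "etau W (einv W i) = eiota W i"
    and einv_einv: "einv W (einv W i) = i"
proof -
  obtain s e where i: "i = (s, e)" and s: "s \<in> gens M" and e: "e \<in> edges (panel_groupoid W s)"
    and n: "e \<notin> ident (panel_groupoid W s) ` chambers W"
    using assms by (auto simp: typed_edges_def)
  note P = groupoidD[OF panel[OF s]] and ii = groupoid_inverse_inverse[OF panel[OF s] e]
  show "eiota W i \<in> chambers W" "etau W i \<in> chambers W"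
    "eiota W (einv W i) = etau W i" "etau W (einv W i) = eiota W i" "einv W (einv W i) = i"
    using P(2,3,14,15)[OF e] verts_panel[OF s] ii by (auto simp: i eiota_def etau_def einv_def)
  \<comment> \<open>An identity is its own inverse, so if the inverse of \<open>e\<close> were an
    identity, \<open>e\<close> would be one too.\<close>
  have "inverse_edge (panel_groupoid W s) e \<notin> ident (panel_groupoid W s) ` chambers W"
    using ii n groupoid_inverse_ident[OF panel[OF s]] verts_panel[OF s] by auto
  then show "einv W i \<in> typed_edges M W"
    using P(13)[OF e] s by (simp add: i einv_def typed_edges_def)
qed

text \<open>By uniqueness of inverses the composite can be an identity only for
  \<open>j = einv W i\<close>. This is why the move \<open>compose\<close> excludes that case,
  identities not being edges.\<close>

lemma eseq:
  assumes i: "i \<in> typed_edges M W" and j: "j \<in> typed_edges M W"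
    and t: "fst i = fst j" and c: "etau W i = eiota W j"
  shows eiota_eseq: "eiota W (eseq W i j) = eiota W i"
    and etau_eseq: "etau W (eseq W i j) = etau W j"
    and eseq_edge: "j \<noteq> einv W i \<Longrightarrow> eseq W i j \<in> typed_edges M W"
proof -
  obtain s e f where ij: "i = (s, e)" "j = (s, f)" and s: "s \<in> gens M"
    and e: "e \<in> edges (panel_groupoid W s)" and f: "f \<in> edges (panel_groupoid W s)"
    using assms by (auto simp: typed_edges_def)
  have c': "tau (panel_groupoid W s) e = iota (panel_groupoid W s) f"
    using c by (simp add: ij etau_def eiota_def)
  note P = groupoidD(4-6)[OF panel[OF s] e f c']
  show "eiota W (eseq W i j) = eiota W i" "etau W (eseq W i j) = etau W j"
    using P by (auto simp: ij etau_def eiota_def eseq_def)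
  show "eseq W i j \<in> typed_edges M W" if "j \<noteq> einv W i"
  proof -
    have "seq (panel_groupoid W s) e f \<notin> ident (panel_groupoid W s) ` chambers W"
    proof
      assume "seq (panel_groupoid W s) e f \<in> ident (panel_groupoid W s) ` chambers W"
      then have "seq (panel_groupoid W s) e f = ident (panel_groupoid W s) (iota (panel_groupoid W s) e)"
        using P(2) groupoidD(9)[OF panel[OF s]] verts_panel[OF s] by auto
      then show False
        using groupoid_inverse_unique[OF panel[OF s] e f c'] that by (simp add: ij einv_def)
    qed
    then show ?thesis using P(1) s by (simp add: ij eseq_def typed_edges_def)
  qed
qed

lemma gtau_chamber: "gallery M W b \<Longrightarrow> gtau W b \<in> chambers W"
  using etau_chamber[of "last (snd b)"] unfolding gallery_def gtau_def
  by (auto simp: subset_iff simp del: split_paired_All)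

lemma gallery_Nil [simp]: "gallery M W (C, []) \<longleftrightarrow> C \<in> chambers W"
  by (simp add: gallery_def)

lemma gallery_append:
  "gallery M W (C, xs @ ys) \<longleftrightarrow> gallery M W (C, xs) \<and> gallery M W (gtau W (C, xs), ys)"
  using gtau_chamber[of "(C, xs)"] by (auto simp: gallery_def consecutive_append)

lemma gallery_Cons:
  "gallery M W (C, i # is) \<longleftrightarrow>
     i \<in> typed_edges M W \<and> eiota W i = C \<and> gallery M W (etau W i, is)"
  using eiota_chamber[of i] etau_chamber[of i] by (auto simp: gallery_def)

lemma st_cycle_defining_suite:
  "defining_suite M W b \<Longrightarrow> \<exists>s t. st_cycle M W s t b"
  using weyl_data unfolding weyl_data_def defining_suite_def by blast

lemma defining_suite:
  assumes "defining_suite M W b"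
  shows "gallery M W b" "gtau W b = fst b"
  using st_cycle_defining_suite[OF assms] by (auto simp: st_cycle_def giota_def)

section \<open>Elementary homotopies and homotopy\<close>

abbreviation "eh \<equiv> elementary_homotopy M W"

text \<open>Each move replaces a segment by one with the same extremities, a defining suite being
  closed. The moves require only the longer side to be a gallery; the shorter side then is one
  too.\<close>

lemma eh_galleries:
  assumes "eh b b'"
  shows eh_gallery1: "gallery M W b" and eh_gallery2: "gallery M W b'"
    and eh_fst: "fst b' = fst b" and eh_gtau: "gtau W b' = gtau W b"
proof -
  have "gallery M W b \<and> gallery M W b' \<and> fst b' = fst b \<and> gtau W b' = gtau W b"
    using assms
  proof cases
    case (cancel C xs i ys)
    then show ?thesis by (auto simp: gallery_append gallery_Cons etau_einv)
  next
    case (compose C xs i i' ys)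
    then show ?thesis by (auto simp: gallery_append gallery_Cons eseq)
  next
    case (suite C xs us ys)
    then show ?thesis using defining_suite[OF suite(4)] by (auto simp: gallery_append)
  qed
  then show "gallery M W b" "gallery M W b'" "fst b' = fst b" "gtau W b' = gtau W b" by auto
qed

text \<open>Every move already allows an arbitrary prefix and suffix, which are merely enlarged. The
  prefix enters the move \<open>suite\<close> through its terminal chamber, hence the last
  premise.\<close>

lemma eh_context:
  assumes "eh (C, us) (C, vs)" "gallery M W (A, xs @ us @ ys)" "gtau W (A, xs) = C"
  shows "eh (A, xs @ us @ ys) (A, xs @ vs @ ys)"
  using assms(1)
proof cases
  case (cancel xs' i ys')
  then show ?thesis
    using elementary_homotopy.cancel[of M W A "xs @ xs'" i "ys' @ ys"] assms(2) by simp
next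
  case (compose xs' i i' ys')
  then show ?thesis
    using elementary_homotopy.compose[of M W A "xs @ xs'" i i' "ys' @ ys"] assms(2) by simp
next
  case (suite xs' us' ys')
  then show ?thesis
    using elementary_homotopy.suite[of M W A "xs @ xs'" us' "ys' @ ys"] assms(2,3) by simp
qed

lemma homotopic_refl: "gallery M W b \<Longrightarrow> homotopic M W b b"
  by (simp add: homotopic_def)

lemma homotopic_sym: "homotopic M W b b' \<Longrightarrow> homotopic M W b' b"
  by (auto simp: homotopic_def intro: equivclp_sym)

lemma homotopic_trans: "homotopic M W a b \<Longrightarrow> homotopic M W b c \<Longrightarrow> homotopic M W a c"
  by (auto simp: homotopic_def intro: equivclp_trans)

lemma homotopic_eh: "eh b b' \<Longrightarrow> homotopic M W b b'"
  using eh_gallery1 eh_gallery2 by (auto simp: homotopic_def)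

lemma homotopic_gallery:
  "homotopic M W b b' \<Longrightarrow> gallery M W b" "homotopic M W b b' \<Longrightarrow> gallery M W b'"
  by (auto simp: homotopic_def)

text \<open>Induction along a zigzag of moves. The extra premise \<open>homotopic M W b y\<close>
  makes each intermediate object available as a gallery with the same ends as
  \<open>b\<close>.\<close>

lemma homotopic_induct [consumes 1, case_names refl forward backward]:
  assumes "homotopic M W b b'" and "P b"
    and "\<And>y z. homotopic M W b y \<Longrightarrow> P y \<Longrightarrow> eh y z \<Longrightarrow> P z"
    and "\<And>y z. homotopic M W b y \<Longrightarrow> P y \<Longrightarrow> eh z y \<Longrightarrow> P z"
  shows "P b'"
proof -
  have g: "gallery M W b" and "equivclp eh b b'" using assms(1) by (auto simp: homotopic_def)
  from this(2) have "homotopic M W b b' \<and> P b'"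
  proof (induction rule: equivclp_induct)
    case base
    then show ?case using g assms(2) homotopic_refl by simp
  next
    case (step y z)
    from step(2) show ?case
    proof
      assume "eh y z"
      then show ?thesis using step(3) assms(3) homotopic_trans homotopic_eh by blast
    next
      assume "eh z y"
      then show ?thesis using step(3) assms(4) homotopic_trans homotopic_eh homotopic_sym by blast
    qed
  qed
  then show ?thesis ..
qed

lemma homotopic_ends:
  assumes "homotopic M W b b'"
  shows homotopic_fst: "fst b' = fst b" and homotopic_gtau: "gtau W b' = gtau W b"
proof -
  from assms have "fst b' = fst b \<and> gtau W b' = gtau W b"
    by (induction rule: homotopic_induct) (auto simp: eh_fst eh_gtau)
  then show "fst b' = fst b" "gtau W b' = gtau W b" by auto
qed

lemma homotopic_context:
  assumes "homotopic M W (C, us) (C, vs)" "gallery M W (A, xs @ us @ ys)" "gtau W (A, xs) = C"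
  shows "homotopic M W (A, xs @ us @ ys) (A, xs @ vs @ ys)"
proof -
  have "\<forall>vs. b' = (C, vs) \<longrightarrow> homotopic M W (A, xs @ us @ ys) (A, xs @ vs @ ys)"
    if "homotopic M W (C, us) b'" for b'
    using that
  proof (induction rule: homotopic_induct)
    case refl
    then show ?case using homotopic_refl[OF assms(2)] by simp
  next
    case (forward y z)
    obtain ws where y: "y = (C, ws)" using homotopic_fst[OF forward.hyps(1)] by (cases y) auto
    have h: "homotopic M W (A, xs @ us @ ys) (A, xs @ ws @ ys)" using forward.IH y by simp
    show ?case
    proof (intro allI impI)
      fix vs assume "z = (C, vs)"
      then have "eh (A, xs @ ws @ ys) (A, xs @ vs @ ys)"
        using eh_context[OF _ homotopic_gallery(2)[OF h] assms(3)] forward.hyps(2) y by simp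
      then show "homotopic M W (A, xs @ us @ ys) (A, xs @ vs @ ys)"
        using homotopic_trans[OF h homotopic_eh] by simp
    qed
  next
    case (backward y z)
    obtain ws where y: "y = (C, ws)" using homotopic_fst[OF backward.hyps(1)] by (cases y) auto
    have h: "homotopic M W (A, xs @ us @ ys) (A, xs @ ws @ ys)" using backward.IH y by simp
    show ?case
    proof (intro allI impI)
      fix vs assume z: "z = (C, vs)"
      \<comment> \<open>A backward move starts from \<open>vs\<close>, which is not yet known to fit
        between \<open>xs\<close> and \<open>ys\<close>; it does, because \<open>vs\<close> and
        \<open>ws\<close> have the same ends.\<close>
      have "gallery M W (A, xs @ vs @ ys)"
        using homotopic_gallery(2)[OF h] eh_gallery1[OF backward.hyps(2)] eh_gtau[OF backward.hyps(2)]
        by (auto simp: y z gallery_append assms(3))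
      then have "eh (A, xs @ vs @ ys) (A, xs @ ws @ ys)"
        using eh_context[OF _ _ assms(3)] backward.hyps(2) y z by simp
      then show "homotopic M W (A, xs @ us @ ys) (A, xs @ vs @ ys)"
        using homotopic_trans[OF h homotopic_sym[OF homotopic_eh]] by simp
    qed
  qed
  then show ?thesis using assms(1) by blast
qed

lemma homotopic_append:
  assumes b: "homotopic M W (C, us) (C, us')" and c: "homotopic M W (D, vs) (D, vs')"
    and D: "gtau W (C, us) = D"
  shows "homotopic M W (C, us @ vs) (C, us' @ vs')"
proof -
  have D': "gtau W (C, us') = D" using homotopic_gtau[OF b] D by simp
  have "homotopic M W (C, [] @ us @ vs) (C, [] @ us' @ vs)"
    by (rule homotopic_context[OF b])
      (use homotopic_gallery(1)[OF b] homotopic_gallery(1)[OF c] D in \<open>auto simp: gallery_append\<close>)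
  moreover have "homotopic M W (C, us' @ vs @ []) (C, us' @ vs' @ [])"
    by (rule homotopic_context[OF c])
      (use homotopic_gallery(2)[OF b] homotopic_gallery(1)[OF c] D' in \<open>auto simp: gallery_append\<close>)
  ultimately show ?thesis using homotopic_trans by auto
qed

lemma homotopic_gappend:
  assumes "homotopic M W b b'" "homotopic M W c c'" "gtau W b = giota c"
  shows "homotopic M W (gappend b c) (gappend b' c')"
  using homotopic_append[of "fst b" "snd b" "snd b'" "fst c" "snd c" "snd c'"]
    homotopic_fst[OF assms(1)] homotopic_fst[OF assms(2)] assms
  by (cases b; cases b'; cases c; cases c') (simp add: gappend_def giota_def)

section \<open>Concatenation and reversal of galleries\<close>

lemma gallery_gappend:
  "\<lbrakk>gallery M W b; gallery M W c; gtau W b = giota c\<rbrakk> \<Longrightarrow> gallery M W (gappend b c)"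
  by (cases b; cases c) (simp add: gappend_def giota_def gallery_append)

lemma gtau_gappend: "gtau W b = giota c \<Longrightarrow> gtau W (gappend b c) = gtau W c"
  by (cases b; cases c) (simp add: gappend_def giota_def)

text \<open>The reverse of \<open>i # xs\<close> ends with the inverse of \<open>i\<close>.
  Contracting \<open>xs\<close> against its own reverse brings \<open>i\<close> next to
  \<open>einv W i\<close>, and these two cancel.\<close>

lemma greverse_gallery:
  assumes "gallery M W (C, xs)"
  shows "gallery M W (greverse W (C, xs))" "gtau W (greverse W (C, xs)) = C"
    "greverse W (greverse W (C, xs)) = (C, xs)"
    "homotopic M W (C, xs @ snd (greverse W (C, xs))) (C, [])"
proof -
  have "gallery M W (greverse W (C, xs)) \<and> gtau W (greverse W (C, xs)) = C \<and>
    greverse W (greverse W (C, xs)) = (C, xs) \<and>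
    homotopic M W (C, xs @ snd (greverse W (C, xs))) (C, [])"
    using assms
  proof (induction xs arbitrary: C)
    case Nil
    then show ?case by (auto simp: greverse_def homotopic_refl)
  next
    case (Cons i xs)
    then have i: "i \<in> typed_edges M W" "eiota W i = C" and xs: "gallery M W (etau W i, xs)"
      by (auto simp: gallery_Cons)
    note IH = Cons.IH[OF xs]
    let ?r = "rev (map (einv W) xs)" and ?D = "gtau W (etau W i, xs)"
    have r: "gallery M W (?D, ?r)" "gtau W (?D, ?r) = etau W i" "map (einv W \<circ> einv W) xs = xs"
      "homotopic M W (etau W i, xs @ ?r) (etau W i, [])"
      using IH by (auto simp: greverse_def rev_map)
    have g: "gallery M W (C, i # xs @ ?r @ [einv W i])"
      using Cons.prems i r by (auto simp: gallery_append gallery_Cons typed_edgeD)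
    have "homotopic M W (C, [i] @ (xs @ ?r) @ [einv W i]) (C, [i] @ [] @ [einv W i])"
      by (rule homotopic_context[OF r(4)]) (use g in auto)
    moreover have "eh (C, [] @ [i, einv W i] @ []) (C, [] @ [])"
      by (rule elementary_homotopy.cancel) (use i in \<open>auto simp: gallery_Cons typed_edgeD\<close>)
    ultimately have "homotopic M W (C, (i # xs) @ ?r @ [einv W i]) (C, [])"
      using homotopic_eh homotopic_trans by fastforce
    then show ?case
      using i r by (auto simp: greverse_def gallery_append gallery_Cons typed_edgeD rev_map)
  qed
  then show "gallery M W (greverse W (C, xs))" "gtau W (greverse W (C, xs)) = C"
    "greverse W (greverse W (C, xs)) = (C, xs)"
    "homotopic M W (C, xs @ snd (greverse W (C, xs))) (C, [])" by auto
qed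

lemma greverse:
  assumes b: "gallery M W b"
  shows gallery_greverse: "gallery M W (greverse W b)"
    and gtau_greverse: "gtau W (greverse W b) = giota b"
    and giota_greverse: "giota (greverse W b) = gtau W b"
    and gappend_greverse: "homotopic M W (gappend b (greverse W b)) (giota b, [])"
    and greverse_gappend: "homotopic M W (gappend (greverse W b) b) (gtau W b, [])"
proof -
  obtain C xs where C: "b = (C, xs)" by (cases b)
  note g = greverse_gallery[OF b[unfolded C]]
  show "gallery M W (greverse W b)" "gtau W (greverse W b) = giota b"
    "giota (greverse W b) = gtau W b" "homotopic M W (gappend b (greverse W b)) (giota b, [])"
    using g by (auto simp: C giota_def gappend_def greverse_def)
  \<comment> \<open>The product in the other order is the same fact applied to the reversed gallery,
    whose reverse is \<open>b\<close>.\<close>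
  obtain D ys where D: "greverse W b = (D, ys)" by (cases "greverse W b")
  have "homotopic M W (D, ys @ snd (greverse W (D, ys))) (D, [])"
    using greverse_gallery(4)[of D ys] g(1) D C by simp
  moreover have "greverse W (D, ys) = b" "D = gtau W b" using g(3) C D by (auto simp: greverse_def)
  ultimately show "homotopic M W (gappend (greverse W b) b) (gtau W b, [])"
    by (simp add: gappend_def D)
qed

lemma gappend_Nil [simp]: "gappend b (C, []) = b" "gappend (giota b, []) b = b"
  by (simp_all add: gappend_def giota_def)

lemma gappend_assoc: "gappend (gappend a b) c = gappend a (gappend b c)"
  by (simp add: gappend_def)

text \<open>Uniqueness of inverses up to homotopy: with \<open>r\<close>, \<open>r'\<close> the
  reverses of \<open>b\<close>, \<open>b'\<close>, the chain is \<open>r\<close> ~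
  \<open>r b' r'\<close> ~ \<open>r b r'\<close> ~ \<open>r'\<close>. Moves are not reversed one by
  one, since the reverse of a defining suite need not be a defining suite.\<close>

lemma homotopic_greverse:
  assumes h: "homotopic M W b b'"
  shows "homotopic M W (greverse W b) (greverse W b')"
proof -
  let ?r = "greverse W b" and ?r' = "greverse W b'"
  have g: "gallery M W b" "gallery M W b'" using homotopic_gallery[OF h] by auto
  have e: "giota b' = giota b" "gtau W b' = gtau W b"
    using homotopic_ends[OF h] by (auto simp: giota_def)
  note r = greverse[OF g(1)] and r' = greverse[OF g(2)]
  have 1: "homotopic M W (gappend ?r (giota b, [])) (gappend ?r (gappend b' ?r'))"
    by (rule homotopic_gappend) (use r r' e homotopic_refl homotopic_sym in \<open>auto simp: giota_def\<close>)
  have 2: "homotopic M W (gappend ?r (gappend b' ?r')) (gappend ?r (gappend b ?r'))"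
    by (intro homotopic_gappend homotopic_refl homotopic_sym[OF h])
      (use r r' e in \<open>auto simp: giota_def gappend_def\<close>)
  have 3: "homotopic M W (gappend (gappend ?r b) ?r') (gappend (giota ?r', []) ?r')"
    by (intro homotopic_gappend homotopic_refl)
      (use r r' e gtau_gappend in \<open>auto\<close>)
  show ?thesis using homotopic_trans[OF homotopic_trans[OF 1 2]] 3 by (simp add: gappend_assoc)
qed

section \<open>The fundamental groupoid\<close>

lemma hclass_eq_iff:
  assumes "gallery M W b"
  shows "hclass M W b = hclass M W b' \<longleftrightarrow> homotopic M W b b'"
proof
  assume "hclass M W b = hclass M W b'"
  then have "b \<in> hclass M W b'" using homotopic_refl[OF assms] by (auto simp: hclass_def)
  then show "homotopic M W b b'" by (simp add: hclass_def homotopic_sym)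
next
  assume "homotopic M W b b'"
  then have "homotopic M W b c \<longleftrightarrow> homotopic M W b' c" for c
    using homotopic_sym homotopic_trans by blast
  then show "hclass M W b = hclass M W b'" unfolding hclass_def by blast
qed

abbreviation "F \<equiv> fundamental_groupoid M W"

lemma verts_F [simp]: "verts F = chambers W"
  and ident_F [simp]: "ident F C = hclass M W (C, [])"
  by (simp_all add: fundamental_groupoid_def)

lemma edges_F: "X \<in> edges F \<longleftrightarrow> (\<exists>b. gallery M W b \<and> X = hclass M W b)"
  by (auto simp: fundamental_groupoid_def)

lemma hclass_edge: "gallery M W b \<Longrightarrow> hclass M W b \<in> edges F"
  unfolding edges_F by blast

lemma iota_F: "gallery M W b \<Longrightarrow> iota F (hclass M W b) = giota b"
proof -
  assume g: "gallery M W b"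
  then have "giota ` hclass M W b = {giota b}"
    using homotopic_refl[OF g] homotopic_fst by (fastforce simp: hclass_def giota_def)
  then show ?thesis by (simp add: fundamental_groupoid_def)
qed

lemma tau_F: "gallery M W b \<Longrightarrow> tau F (hclass M W b) = gtau W b"
proof -
  assume g: "gallery M W b"
  then have "gtau W ` hclass M W b = {gtau W b}"
    using homotopic_refl[OF g] homotopic_gtau by (fastforce simp: hclass_def)
  then show ?thesis by (simp add: fundamental_groupoid_def)
qed

text \<open>Inverses in the fundamental groupoid and the induced homomorphism are encoded as unions
  over all representatives; such a union collapses once its members do not depend on the
  representative.\<close>

lemma UN_hclass:
  assumes "gallery M W b" "\<And>b'. homotopic M W b b' \<Longrightarrow> f b' = f b"
  shows "(\<Union>b'\<in>hclass M W b. f b') = f b"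
  using assms homotopic_refl[OF assms(1)] by (force simp: hclass_def)

lemma seq_F:
  assumes b: "gallery M W b" and c: "gallery M W c" and t: "gtau W b = giota c"
  shows "seq F (hclass M W b) (hclass M W c) = hclass M W (gappend b c)"
proof -
  have "hclass M W (gappend b' c') = hclass M W (gappend b c)"
    if "homotopic M W b b'" "homotopic M W c c'" for b' c'
    using homotopic_gappend[OF that t] hclass_eq_iff gallery_gappend[OF b c t] by blast
  then have "(\<Union>b'\<in>hclass M W b. \<Union>c'\<in>hclass M W c. hclass M W (gappend b' c')) =
     hclass M W (gappend b c)"
    using homotopic_refl[OF b] homotopic_refl[OF c] unfolding hclass_def[of M W b] hclass_def[of M W c]
    by blast
  then show ?thesis by (simp add: fundamental_groupoid_def)
qed

lemma inverse_F:
  assumes b: "gallery M W b"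
  shows "inverse_edge F (hclass M W b) = hclass M W (greverse W b)"
proof -
  have "(\<Union>b'\<in>hclass M W b. hclass M W (greverse W b')) = hclass M W (greverse W b)"
    by (rule UN_hclass[OF b])
      (use homotopic_greverse hclass_eq_iff gallery_greverse[OF b] in blast)
  then show ?thesis by (simp add: fundamental_groupoid_def)
qed

lemma groupoid_F: "groupoid F"
  unfolding groupoid_def
proof (intro conjI ballI impI)
  show "verts F \<noteq> {}" using weyl_data by (auto simp: weyl_data_def chamber_system_def)
next
  fix X assume "X \<in> edges F"
  then obtain b where b: "gallery M W b" and X: "X = hclass M W b" by (auto simp: edges_F)
  note r = greverse[OF b]
  show "iota F X \<in> verts F" "tau F X \<in> verts F"
    using b gtau_chamber by (auto simp: X iota_F tau_F giota_def gallery_def)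
  have c: "giota b \<in> chambers W" "gtau W b \<in> chambers W"
    using b gtau_chamber by (auto simp: giota_def gallery_def)
  show "seq F (ident F (iota F X)) X = X"
    using b c seq_F[of "(giota b, [])" b] by (simp add: X iota_F)
  show "seq F X (ident F (tau F X)) = X"
    using b c seq_F[of b "(gtau W b, [])"] by (simp add: X tau_F giota_def)
  show "inverse_edge F X \<in> edges F" "iota F (inverse_edge F X) = tau F X"
    "tau F (inverse_edge F X) = iota F X"
    using b r hclass_edge by (simp_all add: X inverse_F iota_F tau_F)
  show "seq F X (inverse_edge F X) = ident F (iota F X)"
    using b r seq_F[of b "greverse W b"] hclass_eq_iff gallery_gappend[of b "greverse W b"]
    by (simp add: X inverse_F iota_F)
  show "seq F (inverse_edge F X) X = ident F (tau F X)"
    using b r seq_F[of "greverse W b" b] hclass_eq_iff gallery_gappend[of "greverse W b" b]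
    by (simp add: X inverse_F tau_F)
next
  fix X Y assume "X \<in> edges F" "Y \<in> edges F" and t: "tau F X = iota F Y"
  then obtain b c where b: "gallery M W b" "X = hclass M W b" and c: "gallery M W c" "Y = hclass M W c"
    by (auto simp: edges_F)
  have bc: "gtau W b = giota c" using t b c by (simp add: iota_F tau_F)
  note g = gallery_gappend[OF b(1) c(1) bc]
  show "seq F X Y \<in> edges F" "iota F (seq F X Y) = iota F X" "tau F (seq F X Y) = tau F Y"
    using g b c bc hclass_edge[OF g] seq_F[OF b(1) c(1) bc] gtau_gappend[OF bc] iota_F[OF g] tau_F[OF g]
      iota_F[OF b(1)] tau_F[OF c(1)]
    by (auto simp: gappend_def giota_def)
  fix Z assume "Z \<in> edges F" and t': "tau F Y = iota F Z"
  then obtain d where d: "gallery M W d" "Z = hclass M W d" by (auto simp: edges_F)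
  have cd: "gtau W c = giota d" using t' d c by (simp add: iota_F tau_F)
  note g' = gallery_gappend[OF c(1) d(1) cd]
  have "seq F (seq F X Y) Z = hclass M W (gappend (gappend b c) d)"
    using seq_F[OF b(1) c(1) bc] seq_F[OF g d(1)] gtau_gappend[OF bc] cd b c d by simp
  moreover have "seq F X (seq F Y Z) = hclass M W (gappend b (gappend c d))"
    using seq_F[OF c(1) d(1) cd] seq_F[OF b(1) g'] bc b c d by (simp add: gappend_def giota_def)
  ultimately show "seq F (seq F X Y) Z = seq F X (seq F Y Z)" by (simp add: gappend_assoc)
next
  fix C assume "C \<in> verts F"
  then show "ident F C \<in> edges F" "iota F (ident F C) = C" "tau F (ident F C) = C"
    by (auto simp: hclass_edge iota_F tau_F giota_def)
qed


section \<open>Suites and panel edges in the fundamental groupoid\<close>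

lemma suite_gallery_defining:
  assumes "defining_suite M W b"
  shows "suite_gallery M W b"
proof -
  have "eh (fst b, [] @ snd b @ []) (fst b, [] @ [])"
    using defining_suite[OF assms] assms by (intro elementary_homotopy.suite) auto
  then have "homotopic M W b (fst b, [])" using homotopic_eh by simp
  then show ?thesis using st_cycle_defining_suite[OF assms] by (auto simp: suite_gallery_def)
qed

text \<open>An identity of a panel groupoid is not an edge of the chamber system; it is sent to the
  trivial gallery.\<close>

definition edge_gallery :: "'s \<Rightarrow> 'e \<Rightarrow> ('s, 'c, 'e) gallery" where
  "edge_gallery s e =
     (iota (panel_groupoid W s) e,
      if e \<in> ident (panel_groupoid W s) ` chambers W then [] else [(s, e)])"

lemma giota_edge_gallery [simp]: "giota (edge_gallery s e) = iota (panel_groupoid W s) e"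
  by (simp add: edge_gallery_def giota_def)

lemma edge_gallery:
  assumes s: "s \<in> gens M" and e: "e \<in> edges (panel_groupoid W s)"
  shows gallery_edge_gallery: "gallery M W (edge_gallery s e)"
    and gtau_edge_gallery: "gtau W (edge_gallery s e) = tau (panel_groupoid W s) e"
  using groupoidD(2,3,9,10)[OF panel[OF s]] e s verts_panel[OF s]
  by (auto simp: edge_gallery_def gallery_Cons typed_edges_def eiota_def etau_def)

lemma edge_gallery_typed:
  "(s, e) \<in> typed_edges M W \<Longrightarrow> edge_gallery s e = (eiota W (s, e), [(s, e)])"
  by (simp add: edge_gallery_def typed_edges_def eiota_def)

lemma edge_gallery_ident:
  "\<lbrakk>s \<in> gens M; C \<in> chambers W\<rbrakk> \<Longrightarrow> edge_gallery s (ident (panel_groupoid W s) C) = (C, [])"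
  using groupoidD(9)[OF panel[of s]] verts_panel by (simp add: edge_gallery_def)

text \<open>The cases mirror the moves: an identity factor contributes nothing, two mutually inverse
  edges cancel, and any other pair of edges composes.\<close>

lemma homotopic_edge_gallery_seq:
  assumes s: "s \<in> gens M" and e: "e \<in> edges (panel_groupoid W s)"
    and f: "f \<in> edges (panel_groupoid W s)"
    and c: "tau (panel_groupoid W s) e = iota (panel_groupoid W s) f"
  shows "homotopic M W (gappend (edge_gallery s e) (edge_gallery s f))
    (edge_gallery s (seq (panel_groupoid W s) e f))" (is "homotopic M W ?b _")
proof -
  let ?P = "panel_groupoid W s"
  note P = panel[OF s] verts_panel[OF s]
  have g: "gallery M W ?b"
    using gallery_gappend[of "edge_gallery s e" "edge_gallery s f"] edge_gallery[OF s] e f c by simp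
  note r = homotopic_refl[OF g]
  consider C where "C \<in> chambers W" "e = ident ?P C" | C where "C \<in> chambers W" "f = ident ?P C"
    | "(s, e) \<in> typed_edges M W" "(s, f) \<in> typed_edges M W"
    using s e f by (auto simp: typed_edges_def)
  then show ?thesis
  proof cases
    case 1
    then have "C = iota ?P f" using groupoidD(10)[OF P(1)] P(2) c by simp
    then show ?thesis
      using r groupoidD(11)[OF P(1) f] edge_gallery_ident[OF s 1(1)] 1(2)
        gappend_Nil(2)[of "edge_gallery s f"] by simp
  next
    case 2
    then have "C = tau ?P e" using groupoidD(9)[OF P(1)] P(2) c by simp
    then show ?thesis
      using r groupoidD(12)[OF P(1) e] edge_gallery_ident[OF s 2(1)] 2(2) by simp
  next
    case 3
    have b: "?b = (iota ?P e, [(s, e), (s, f)])"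
      using 3 by (simp add: edge_gallery_typed gappend_def eiota_def)
    show ?thesis
    proof (cases "f = inverse_edge ?P e")
      case True
      then have "einv W (s, e) = (s, f)" by (simp add: einv_def)
      then have "eh ?b (iota ?P e, [])"
        using elementary_homotopy.cancel[of M W "iota ?P e" "[]" "(s, e)" "[]"] g b by simp
      moreover have "edge_gallery s (seq ?P e f) = (iota ?P e, [])"
        using True groupoidD(16)[OF P(1) e] groupoidD(2)[OF P(1) e] edge_gallery_ident[OF s] P(2) by simp
      ultimately show ?thesis using homotopic_eh by simp
    next
      case False
      then have n: "(s, f) \<noteq> einv W (s, e)" by (simp add: einv_def)
      then have "eh ?b (iota ?P e, [eseq W (s, e) (s, f)])"
        using elementary_homotopy.compose[of M W "iota ?P e" "[]" "(s, e)" "(s, f)" "[]"] g b by simp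
      moreover have "eseq W (s, e) (s, f) = (s, seq ?P e f)" by (simp add: eseq_def)
      moreover from this have "(s, seq ?P e f) \<in> typed_edges M W"
        using eseq_edge[OF 3] n c by (simp add: eiota_def etau_def)
      then have "edge_gallery s (seq ?P e f) = (iota ?P e, [(s, seq ?P e f)])"
        using groupoidD(5)[OF P(1) e f c] by (simp add: edge_gallery_typed eiota_def)
      ultimately show ?thesis using homotopic_eh by simp
    qed
  qed
qed

text \<open>The homomorphism from the \<open>s\<close>-panel groupoid to the fundamental groupoid
  that is the identity on chambers.\<close>

abbreviation edge_class :: "'s \<Rightarrow> 'e \<Rightarrow> ('s, 'c, 'e) gallery set" where
  "edge_class s e \<equiv> hclass M W (edge_gallery s e)"

lemma edge_class:
  assumes "s \<in> gens M" "e \<in> edges (panel_groupoid W s)"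
  shows "edge_class s e \<in> edges F" "iota F (edge_class s e) = iota (panel_groupoid W s) e"
    "tau F (edge_class s e) = tau (panel_groupoid W s) e"
  using gallery_edge_gallery[OF assms] gtau_edge_gallery[OF assms]
  by (simp_all add: hclass_edge iota_F tau_F)

lemma edge_class_seq:
  assumes "s \<in> gens M" "e \<in> edges (panel_groupoid W s)" "f \<in> edges (panel_groupoid W s)"
    and "tau (panel_groupoid W s) e = iota (panel_groupoid W s) f"
  shows "edge_class s (seq (panel_groupoid W s) e f) = seq F (edge_class s e) (edge_class s f)"
proof -
  note h = homotopic_edge_gallery_seq[OF assms]
  show ?thesis
    using iffD2[OF hclass_eq_iff[OF homotopic_gallery(1)[OF h]] h] edge_gallery[OF assms(1)] assms
      seq_F[of "edge_gallery s e" "edge_gallery s f"] by simp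
qed

end

section \<open>The covering attached to a covering of the fundamental groupoid\<close>

locale weyl_cov = weyl M W + groupoid_cov \<phi> G "fundamental_groupoid M W"
  for M :: "'s coxeter" and W :: "('s, 'c, 'e) weyl_data" and G :: "('x, 'g) groupoid"
    and \<phi> :: "('x, 'g, 'c, ('s, 'c, 'e) gallery set) graph_map"
begin

abbreviation "ov \<equiv> on_verts \<phi>"

text \<open>The action groupoid of the \<open>s\<close>-panel groupoid on the fibres of
  \<open>\<phi>\<close>, acting through \<open>edge_class\<close> and \<open>endpoint\<close>;
  equivalently, the pullback of \<open>\<phi>\<close> along \<open>edge_class\<close>.\<close>

definition cover_panel :: "'s \<Rightarrow> ('x, 'x \<times> 'e) groupoid" where
  "cover_panel s =
     \<lparr>verts = verts G,
      edges = {(x, e). x \<in> verts G \<and> e \<in> edges (panel_groupoid W s) \<and>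
        iota (panel_groupoid W s) e = ov x},
      iota = fst,
      tau = (\<lambda>(x, e). endpoint x (edge_class s e)),
      seq = (\<lambda>(x, e) (y, f). (x, seq (panel_groupoid W s) e f)),
      ident = (\<lambda>x. (x, ident (panel_groupoid W s) (ov x))),
      inverse_edge =
        (\<lambda>(x, e). (endpoint x (edge_class s e), inverse_edge (panel_groupoid W s) e))\<rparr>"

text \<open>The defining suites of the covering are galleries of the covering, so its chamber system has to
  be available before them.\<close>

definition cover_system :: "('s, 'x, 'x \<times> 'e) chamber_system" where
  "cover_system = \<lparr>chambers = verts G, panel_groupoid = cover_panel\<rparr>"

definition proj :: "('x, 's \<times> 'x \<times> 'e, 'c, 's \<times> 'e) graph_map" where
  "proj = \<lparr>on_verts = ov, on_edges = (\<lambda>(s, x, e). (s, e))\<rparr>"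

text \<open>Declaring every lift of a defining suite to be a defining suite makes the suite
  condition on coverings immediate and lets suite deletions lift. The price is that these lifts must
  be shown to be cycles.\<close>

definition cover :: "('s, 'x, 'x \<times> 'e) weyl_data" where
  "cover =
     \<lparr>chambers = verts G, panel_groupoid = cover_panel,
      def_suites =
        (\<lambda>s t. {b. gallery M cover_system b \<and> map_gallery proj b \<in> def_suites W s t})\<rparr>"

abbreviation "pe \<equiv> on_edges proj"

lemma proj_simps [simp]: "on_verts proj = ov" "pe (s, x, e) = (s, e)"
  by (simp_all add: proj_def)

lemma fst_pe [simp]: "fst (pe i) = fst i"
  by (cases i) simp

lemma chambers_cover [simp]: "chambers cover = verts G"
  and panel_cover [simp]: "panel_groupoid cover = cover_panel"
  by (simp_all add: cover_def)

lemma cover_edges [simp]: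
  "eiota cover (s, x, e) = x"
  "etau cover (s, x, e) = endpoint x (edge_class s e)"
  "einv cover (s, x, e) = (s, endpoint x (edge_class s e), inverse_edge (panel_groupoid W s) e)"
  "eseq cover (s, x, e) (t, y, f) = (s, x, seq (panel_groupoid W s) e f)"
  by (simp_all add: eiota_def etau_def einv_def eseq_def cover_panel_def)

lemma gallery_cover_system: "gallery M cover_system b = gallery M cover b"
proof -
  have "typed_edges M cover_system = typed_edges M cover"
    by (simp add: typed_edges_def cover_system_def)
  moreover have "consecutive cover_system x is = consecutive cover x is" for x "is"
    by (induction "is" arbitrary: x) (simp_all add: eiota_def etau_def cover_system_def)
  ultimately show ?thesis by (simp add: gallery_def cover_system_def)
qed

lemma ov_chamber: "x \<in> verts G \<Longrightarrow> ov x \<in> chambers W"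
  using homD(1) by simp

lemma typed_cover:
  "(s, x, e) \<in> typed_edges M cover \<longleftrightarrow>
     (s, e) \<in> typed_edges M W \<and> x \<in> verts G \<and> eiota W (s, e) = ov x"
proof -
  \<comment> \<open>The only identity issuing from \<open>ov x\<close> is the one at
    \<open>ov x\<close>, so \<open>(x, e)\<close> is an identity upstairs exactly when
    \<open>e\<close> is one.\<close>
  have "e \<in> ident (panel_groupoid W s) ` chambers W \<longleftrightarrow> e = ident (panel_groupoid W s) (ov x)"
    if "s \<in> gens M" "iota (panel_groupoid W s) e = ov x" "x \<in> verts G"
    using that groupoidD(9)[OF panel[OF that(1)]] verts_panel[OF that(1)] ov_chamber by auto
  then show ?thesis by (auto simp: typed_edges_def cover_panel_def eiota_def)
qed

lemma endpoint_edge: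
  assumes "s \<in> gens M" "x \<in> verts G" "e \<in> edges (panel_groupoid W s)"
    "iota (panel_groupoid W s) e = ov x"
  shows "endpoint x (edge_class s e) \<in> verts G"
    "ov (endpoint x (edge_class s e)) = tau (panel_groupoid W s) e"
  using endpoint[of x "edge_class s e"] edge_class[of s e] assms by simp_all

lemma endpoint_edge_seq:
  assumes "s \<in> gens M" "x \<in> verts G" "e \<in> edges (panel_groupoid W s)"
    "iota (panel_groupoid W s) e = ov x" "f \<in> edges (panel_groupoid W s)"
    "tau (panel_groupoid W s) e = iota (panel_groupoid W s) f"
  shows "endpoint x (edge_class s (seq (panel_groupoid W s) e f)) =
    endpoint (endpoint x (edge_class s e)) (edge_class s f)"
  unfolding edge_class_seq[OF assms(1,3,5,6)]
  by (rule endpoint_seq) (use edge_class[OF assms(1,3)] edge_class[OF assms(1,5)] assms in simp_all)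

lemma endpoint_edge_ident:
  assumes "s \<in> gens M" "x \<in> verts G"
  shows "endpoint x (edge_class s (ident (panel_groupoid W s) (ov x))) = x"
  using edge_gallery_ident[OF assms(1) ov_chamber[OF assms(2)]] endpoint_ident[OF assms(2)] by simp

section \<open>The covering as Weyl data\<close>

lemma groupoid_cover_panel:
  assumes s: "s \<in> gens M"
  shows "groupoid (cover_panel s)"
proof -
  let ?P = "panel_groupoid W s" and ?Q = "cover_panel s"
  note P = groupoidD[OF panel[OF s]] and vP = verts_panel[OF s]
  have Q: "verts ?Q = verts G" "\<And>x e. (x, e) \<in> edges ?Q \<longleftrightarrow> x \<in> verts G \<and> e \<in> edges ?P \<and> iota ?P e = ov x"
    "\<And>x e. iota ?Q (x, e) = x" "\<And>x e. tau ?Q (x, e) = endpoint x (edge_class s e)"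
    "\<And>x e y f. seq ?Q (x, e) (y, f) = (x, seq ?P e f)" "\<And>x. ident ?Q x = (x, ident ?P (ov x))"
    "\<And>x e. inverse_edge ?Q (x, e) = (endpoint x (edge_class s e), inverse_edge ?P e)"
    by (simp_all add: cover_panel_def)
  \<comment> \<open>Transport along \<open>e\<close> and then along its inverse is transport along
    an identity, which fixes \<open>x\<close>.\<close>
  have inv: "endpoint (endpoint x (edge_class s e)) (edge_class s (inverse_edge ?P e)) = x"
    if "x \<in> verts G" "e \<in> edges ?P" "iota ?P e = ov x" for x e
    using endpoint_edge_seq[OF s that P(13)[OF that(2)]] P(14,16)[OF that(2)] that
      endpoint_edge_ident[OF s that(1)] by simp
  have idl: "seq ?P (ident ?P (ov x)) e = e" if "e \<in> edges ?P" "iota ?P e = ov x" for x e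
    using P(11)[OF that(1)] that(2) by simp
  \<comment> \<open>Edges are split into pairs so that the equations \<open>Q\<close>, stated for
    pairs, turn each groupoid axiom into one about \<open>?P\<close> and
    \<open>endpoint\<close>.\<close>
  have ball: "(\<forall>g\<in>edges ?Q. R g) \<longleftrightarrow>
      (\<forall>x e. x \<in> verts G \<longrightarrow> e \<in> edges ?P \<longrightarrow> iota ?P e = ov x \<longrightarrow> R (x, e))" for R
    by (auto simp: Q(2))
  show ?thesis
    unfolding groupoid_def ball Q
    using P vP ov_chamber endpoint_edge[OF s] endpoint_edge_seq[OF s] endpoint_edge_ident[OF s]
      inv idl groupoidD(1)[OF groupoid_total]
    by (intro conjI allI impI) auto
qed

lemma chamber_system_cover: "chamber_system M cover"
  using groupoid_cover_panel groupoidD(1)[OF groupoid_total]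
  by (auto simp: chamber_system_def cover_panel_def)

text \<open>The class of the projection is the class of its first edge followed by that of the rest,
  and \<open>endpoint_seq\<close> transports along the two in turn. The premises spell out what a
  gallery is because the gallery lemmas of \<open>weyl\<close> apply to \<open>cover\<close> only
  after its suites are known to be cycles, which rests on this result.\<close>

lemma project_gallery:
  assumes "x \<in> verts G" "set is \<subseteq> typed_edges M cover" "consecutive cover x is"
  shows "gallery M W (ov x, map pe is)"
    and "gtau cover (x, is) = endpoint x (hclass M W (ov x, map pe is))"
proof -
  have "gallery M W (ov x, map pe is) \<and>
    gtau cover (x, is) = endpoint x (hclass M W (ov x, map pe is))"
    using assms
  proof (induction "is" arbitrary: x)
    case Nil
    then show ?case using ov_chamber endpoint_ident by simp
  next
    case (Cons i "is")
    obtain s e where i: "i = (s, x, e)" using Cons.prems(3) by (cases i) auto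
    have t: "(s, e) \<in> typed_edges M W" "eiota W (s, e) = ov x"
      using Cons.prems(2) by (auto simp: i typed_cover)
    then have e: "s \<in> gens M" "e \<in> edges (panel_groupoid W s)" "iota (panel_groupoid W s) e = ov x"
      by (auto simp: typed_edges_def eiota_def)
    let ?y = "endpoint x (edge_class s e)"
    have y: "?y \<in> verts G" "ov ?y = etau W (s, e)"
      using endpoint_edge[OF e(1) Cons.prems(1) e(2,3)] by (auto simp: etau_def)
    have IH: "gallery M W (ov ?y, map pe is)"
      "gtau cover (?y, is) = endpoint ?y (hclass M W (ov ?y, map pe is))"
      using Cons.IH[OF y(1)] Cons.prems(2,3) by (auto simp: i)
    have g: "edge_gallery s e = (ov x, [(s, e)])" using edge_gallery_typed[OF t(1)] t(2) by simp
    have "hclass M W (ov x, (s, e) # map pe is) =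
        seq F (edge_class s e) (hclass M W (ov ?y, map pe is))"
      using seq_F[OF gallery_edge_gallery[OF e(1,2)] IH(1)] y(2)
      by (simp add: g giota_def gappend_def)
    then show ?case
      using IH t y endpoint_seq[OF Cons.prems(1), of "edge_class s e" "hclass M W (ov ?y, map pe is)"]
        edge_class[OF e(1,2)] e(3) hclass_edge[OF IH(1)] iota_F[OF IH(1)]
      by (simp add: i gallery_Cons giota_def etau_def[of W])
  qed
  then show "gallery M W (ov x, map pe is)"
    "gtau cover (x, is) = endpoint x (hclass M W (ov x, map pe is))" by auto
qed

lemma gallery_proj:
  assumes "gallery M cover b"
  shows gallery_map_gallery: "gallery M W (map_gallery proj b)"
    and gtau_cover: "gtau cover b = endpoint (giota b) (hclass M W (map_gallery proj b))"
  using project_gallery[of "fst b" "snd b"] assms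
  by (simp_all add: gallery_def map_gallery_def giota_def)

lemma def_suites_cover:
  "b \<in> def_suites cover s t \<longleftrightarrow> gallery M cover b \<and> map_gallery proj b \<in> def_suites W s t"
  by (simp add: cover_def[THEN arg_cong[of _ _ def_suites]] gallery_cover_system)

lemma defining_suite_cover:
  "defining_suite M cover b \<longleftrightarrow> gallery M cover b \<and> defining_suite M W (map_gallery proj b)"
  by (auto simp: defining_suite_def def_suites_cover simp del: split_paired_All)

lemma gtype_map_gallery: "gtype (map_gallery proj b) = gtype b"
  by (simp add: gtype_def map_gallery_def)

lemma weyl_data_cover: "weyl_data M cover"
proof -
  have "st_cycle M cover s t b" if "spherical_pair M s t" "b \<in> def_suites cover s t" for s t b
  proof -
    have b: "gallery M cover b" "map_gallery proj b \<in> def_suites W s t"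
      using that(2) by (simp_all add: def_suites_cover)
    then have c: "st_cycle M W s t (map_gallery proj b)"
      using weyl_data that(1) unfolding weyl_data_def by blast
    have "suite_gallery M W (map_gallery proj b)"
      using suite_gallery_defining that(1) b(2) unfolding defining_suite_def by blast
    then obtain C where h: "homotopic M W (map_gallery proj b) (C, [])"
      by (auto simp: suite_gallery_def)
    have "C = ov (giota b)" using homotopic_fst[OF h] by (simp add: map_gallery_def giota_def)
    moreover have "hclass M W (map_gallery proj b) = hclass M W (C, [])"
      using h hclass_eq_iff homotopic_gallery(1) by blast
    moreover have "giota b \<in> verts G" using b(1) by (simp add: gallery_def giota_def)
    \<comment> \<open>\<open>b\<close> ends at the transport of its start along the class of a
      trivial gallery, that is, along an identity.\<close>
    ultimately have "gtau cover b = giota b"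
      using gtau_cover[OF b(1)] endpoint_ident by simp
    then show ?thesis using c b(1) by (simp add: st_cycle_def gtype_map_gallery)
  qed
  then show ?thesis using weyl_data chamber_system_cover by (auto simp: weyl_data_def)
qed

text \<open>The whole calculus of galleries and homotopies now applies upstairs, under the prefix
  \<open>V\<close>.\<close>

sublocale V: weyl M cover
  by (rule weyl.intro) (rule weyl_data_cover)

section \<open>Projection and lifting of galleries and homotopies\<close>

lemma ov_gtau_cover:
  assumes "gallery M cover b"
  shows "ov (gtau cover b) = gtau W (map_gallery proj b)"
proof -
  note g = gallery_map_gallery[OF assms]
  have "giota b \<in> verts G" using assms by (simp add: gallery_def giota_def)
  then show ?thesis
    using project_endpoint[of "giota b" "hclass M W (map_gallery proj b)"] hclass_edge[OF g]
      iota_F[OF g] tau_F[OF g] gtau_cover[OF assms]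
    by (simp add: map_gallery_def giota_def)
qed

lemma pe_edges:
  assumes "i \<in> typed_edges M cover"
  shows pe_typed: "pe i \<in> typed_edges M W" and eiota_pe: "eiota W (pe i) = ov (eiota cover i)"
    and etau_pe: "etau W (pe i) = ov (etau cover i)"
    and pe_einv: "pe (einv cover i) = einv W (pe i)"
proof -
  obtain s x e where i: "i = (s, x, e)" by (cases i)
  then have "s \<in> gens M" "x \<in> verts G" "e \<in> edges (panel_groupoid W s)"
    "iota (panel_groupoid W s) e = ov x" "(s, e) \<in> typed_edges M W"
    using assms unfolding i typed_cover by (auto simp: typed_edges_def eiota_def)
  then show "pe i \<in> typed_edges M W" "eiota W (pe i) = ov (eiota cover i)"
    "etau W (pe i) = ov (etau cover i)" "pe (einv cover i) = einv W (pe i)"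
    using endpoint_edge(2)[of s x e] by (simp_all add: i eiota_def[of W] etau_def[of W] einv_def[of W])
qed

lemma pe_eseq: "fst i = fst j \<Longrightarrow> pe (eseq cover i j) = eseq W (pe i) (pe j)"
  by (cases i; cases j) (simp add: eseq_def[of W])

lemma pe_inj:
  "\<lbrakk>pe i = pe j; eiota cover i = eiota cover j\<rbrakk> \<Longrightarrow> i = j"
  by (cases i; cases j) simp

text \<open>Since \<open>pe\<close> is injective on the edges issuing from one vertex, it reflects
  mutually inverse pairs. Hence the side condition of \<open>compose\<close> survives projection,
  and cancellations lift.\<close>

lemma pe_eq_einv:
  assumes "i \<in> typed_edges M cover" "eiota cover j = etau cover i" "pe j = einv W (pe i)"
  shows "j = einv cover i"
  by (rule pe_inj) (use assms in \<open>simp_all add: pe_einv V.eiota_einv\<close>)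

text \<open>The edge over \<open>u\<close> starting at \<open>x\<close> is forced, and its end lies
  over the start of the remaining gallery, so lifting continues edge by edge.\<close>

lemma gallery_lift:
  assumes "x \<in> verts G" "gallery M W (ov x, us)"
  shows "\<exists>is. gallery M cover (x, is) \<and> map pe is = us"
  using assms
proof (induction us arbitrary: x)
  case Nil
  then show ?case by (intro exI[of _ "[]"]) simp
next
  case (Cons u us)
  obtain s e where u: "u = (s, e)" by (cases u)
  let ?i = "(s, x, e)"
  have i: "?i \<in> typed_edges M cover"
    using Cons.prems by (simp add: u gallery_Cons typed_cover)
  then obtain "is" where "gallery M cover (etau cover ?i, is)" "map pe is = us"
    using Cons.IH[of "etau cover ?i"] Cons.prems V.etau_chamber[OF i] etau_pe[OF i]
    by (auto simp: u gallery_Cons)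
  then show ?case using i by (intro exI[of _ "?i # is"]) (simp add: V.gallery_Cons u)
qed

lemma gallery_lift_unique:
  assumes "gallery M cover (x, is)" "gallery M cover (x, js)" "map pe is = map pe js"
  shows "is = js"
  using assms
proof (induction "is" arbitrary: x js)
  case (Cons i "is")
  then obtain j js' where js: "js = j # js'" "pe i = pe j" "map pe is = map pe js'"
    by (auto simp: Cons_eq_map_conv)
  have "i = j" by (rule pe_inj) (use Cons.prems js in \<open>auto simp: V.gallery_Cons\<close>)
  then show ?case using Cons js by (auto simp: V.gallery_Cons)
qed simp

text \<open>Each move projects to a move of the same kind: \<open>pe\<close> commutes with inverses
  and composites, reflects mutually inverse pairs, and sends defining suites to defining
  suites.\<close>

lemma eh_proj:
  assumes "V.eh b b'"
  shows "eh (map_gallery proj b) (map_gallery proj b')"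
  using assms
proof cases
  case (cancel C xs i ys)
  then have "i \<in> typed_edges M cover" by (auto simp: V.gallery_append V.gallery_Cons)
  then show ?thesis
    using elementary_homotopy.cancel[of M W "ov C" "map pe xs" "pe i" "map pe ys"]
      gallery_map_gallery[OF cancel(3)] cancel
    by (simp add: map_gallery_def pe_einv)
next
  case (compose C xs i i' ys)
  then have i: "i \<in> typed_edges M cover" "eiota cover i' = etau cover i"
    by (auto simp: V.gallery_append V.gallery_Cons)
  then have "pe i' \<noteq> einv W (pe i)" using pe_eq_einv compose by blast
  then show ?thesis
    using elementary_homotopy.compose[of M W "ov C" "map pe xs" "pe i" "pe i'" "map pe ys"]
      gallery_map_gallery[OF compose(3)] compose
    by (simp add: map_gallery_def pe_eseq)
next
  case (suite C xs us ys)
  have "gallery M cover (C, xs)" using suite by (simp add: V.gallery_append)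
  then have "defining_suite M W (gtau W (ov C, map pe xs), map pe us)"
    using suite(4) ov_gtau_cover[of "(C, xs)"] by (simp add: defining_suite_cover map_gallery_def)
  then show ?thesis
    using elementary_homotopy.suite[of M W "ov C" "map pe xs" "map pe us" "map pe ys"]
      gallery_map_gallery[OF suite(3)] suite
    by (simp add: map_gallery_def)
qed

lemma homotopic_proj:
  assumes "homotopic M cover b b'"
  shows "homotopic M W (map_gallery proj b) (map_gallery proj b')"
  using assms
proof (induction rule: V.homotopic_induct)
  case refl
  then show ?case
    using homotopic_refl gallery_map_gallery V.homotopic_gallery(1)[OF assms] by blast
next
  case (forward y z)
  then show ?case using homotopic_trans homotopic_eh[OF eh_proj] by blast
next
  case (backward y z)
  then show ?case using homotopic_trans homotopic_sym homotopic_eh[OF eh_proj] by blast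
qed

text \<open>The segment of \<open>bs\<close> over the segment being changed admits the same kind of
  move; for \<open>suite\<close> this holds because every gallery over a defining suite is a
  defining suite of \<open>cover\<close>.\<close>

lemma eh_lift:
  assumes b: "gallery M cover (x, bs)" and "eh (ov x, map pe bs) (C, vs)"
  shows "\<exists>cs. V.eh (x, bs) (x, cs) \<and> map pe cs = vs"
  using assms(2)
proof cases
  case (cancel xs i ys)
  then obtain xs' j j' ys' where bs: "bs = xs' @ [j, j'] @ ys'" "xs = map pe xs'" "i = pe j"
    "einv W i = pe j'" "ys = map pe ys'"
    by (auto simp: map_eq_append_conv Cons_eq_map_conv map_eq_Cons_conv)
  then have "j' = einv cover j"
    using b pe_eq_einv[of j j'] by (simp add: V.gallery_append V.gallery_Cons)
  then show ?thesis
    using elementary_homotopy.cancel[of M cover x xs' j ys'] b bs cancel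
    by (intro exI[of _ "xs' @ ys'"]) simp
next
  case (compose xs i i' ys)
  then obtain xs' j j' ys' where bs: "bs = xs' @ [j, j'] @ ys'" "xs = map pe xs'" "i = pe j"
    "i' = pe j'" "ys = map pe ys'"
    by (auto simp: map_eq_append_conv Cons_eq_map_conv map_eq_Cons_conv)
  then have "j \<in> typed_edges M cover" using b by (simp add: V.gallery_append V.gallery_Cons)
  then have "j' \<noteq> einv cover j" using compose bs pe_einv[of j] by auto
  then show ?thesis
    using elementary_homotopy.compose[of M cover x xs' j j' ys'] b bs compose pe_eseq[of j j']
    by (intro exI[of _ "xs' @ [eseq cover j j'] @ ys'"]) simp
next
  case (suite xs us ys)
  then have "map pe bs = xs @ us @ ys" by simp
  then obtain xs' zs where "bs = xs' @ zs" "xs = map pe xs'" "map pe zs = us @ ys"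
    unfolding map_eq_append_conv[of pe bs] by metis
  then obtain us' ys' where bs: "bs = xs' @ us' @ ys'" "xs = map pe xs'" "us = map pe us'"
    "ys = map pe ys'"
    unfolding map_eq_append_conv by blast
  have g: "gallery M cover (x, xs')" "gallery M cover (gtau cover (x, xs'), us')"
    using b by (auto simp: bs V.gallery_append)
  then have "defining_suite M cover (gtau cover (x, xs'), us')"
    using suite bs ov_gtau_cover[OF g(1)] by (simp add: defining_suite_cover map_gallery_def)
  then show ?thesis
    using elementary_homotopy.suite[of M cover x xs' us' ys'] b bs suite
    by (intro exI[of _ "xs' @ ys'"]) simp
qed

text \<open>Homotopy lifting, one move at a time; forward moves are covered by
  \<open>eh_lift\<close>.\<close>

lemma homotopic_lift:
  assumes b: "gallery M cover (x, bs)" and h: "homotopic M W (ov x, map pe bs) c"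
  shows "\<exists>cs. homotopic M cover (x, bs) (x, cs) \<and> c = (ov x, map pe cs)"
  using h
proof (induction rule: homotopic_induct)
  case refl
  then show ?case using V.homotopic_refl[OF b] by blast
next
  case (forward y z)
  then obtain cs where cs: "homotopic M cover (x, bs) (x, cs)" "y = (ov x, map pe cs)" by blast
  obtain vs where z: "z = (ov x, vs)" using eh_fst[OF forward.hyps(2)] cs(2) by (cases z) auto
  obtain ds where "V.eh (x, cs) (x, ds)" "map pe ds = vs"
    using eh_lift[OF V.homotopic_gallery(2)[OF cs(1)]] forward.hyps(2) cs(2) z by blast
  then show ?case using cs(1) V.homotopic_trans V.homotopic_eh z by blast
next
  case (backward y z)
  then obtain cs where cs: "homotopic M cover (x, bs) (x, cs)" "y = (ov x, map pe cs)" by blast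
  obtain vs where z: "z = (ov x, vs)" using eh_fst[OF backward.hyps(2)] cs(2) by (cases z) auto
  \<comment> \<open>A backward move starts at a gallery that has no lift yet: lift it, carry out the
    move upstairs, and recognise the result as \<open>cs\<close> by uniqueness of lifts.\<close>
  have "x \<in> verts G" using b by (simp add: gallery_def)
  then obtain ds where ds: "gallery M cover (x, ds)" "map pe ds = vs"
    using gallery_lift eh_gallery1[OF backward.hyps(2)] z by blast
  then obtain cs' where cs': "V.eh (x, ds) (x, cs')" "map pe cs' = map pe cs"
    using eh_lift[OF ds(1)] backward.hyps(2) z cs(2) by blast
  then have "cs' = cs"
    using gallery_lift_unique V.eh_gallery2 V.homotopic_gallery(2)[OF cs(1)] by blast
  then show ?case
    using cs(1) cs'(1) ds(2) V.homotopic_trans V.homotopic_sym V.homotopic_eh z by blast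
qed

section \<open>The induced covering of fundamental groupoids\<close>

lemma induced_hclass:
  assumes "gallery M cover b"
  shows "on_edges (induced_hom M W proj) (hclass M cover b) = hclass M W (map_gallery proj b)"
proof -
  have "(\<Union>b'\<in>hclass M cover b. hclass M W (map_gallery proj b')) = hclass M W (map_gallery proj b)"
    by (rule V.UN_hclass[OF assms])
      (use homotopic_proj hclass_eq_iff gallery_map_gallery[OF assms] in blast)
  then show ?thesis by (simp add: induced_hom_def)
qed

lemma on_verts_induced [simp]: "on_verts (induced_hom M W proj) = ov"
  by (simp add: induced_hom_def)

lemma ov_surj: "ov ` verts G = chambers W"
  using covering by (simp add: groupoid_covering_def)

lemma giota_map_gallery [simp]: "giota (map_gallery proj b) = ov (giota b)"
  by (simp add: map_gallery_def giota_def)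

lemma groupoid_hom_induced: "groupoid_hom (induced_hom M W proj) V.F F"
  unfolding groupoid_hom_def
proof (intro conjI ballI impI)
  show "groupoid V.F" "groupoid F" by (rule V.groupoid_F, rule groupoid_F)
next
  fix x assume "x \<in> verts V.F"
  then show "on_verts (induced_hom M W proj) x \<in> verts F" using ov_chamber by simp
next
  fix X assume "X \<in> edges V.F"
  then obtain b where b: "gallery M cover b" and X: "X = hclass M cover b"
    unfolding V.edges_F by blast
  note g = gallery_map_gallery[OF b]
  show "on_edges (induced_hom M W proj) X \<in> edges F"
    "iota F (on_edges (induced_hom M W proj) X) = on_verts (induced_hom M W proj) (iota V.F X)"
    "tau F (on_edges (induced_hom M W proj) X) = on_verts (induced_hom M W proj) (tau V.F X)"
    using b g by (simp_all add: X induced_hclass hclass_edge iota_F tau_F V.iota_F V.tau_F ov_gtau_cover)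
  fix Y assume "Y \<in> edges V.F" and t: "tau V.F X = iota V.F Y"
  then obtain c where c: "gallery M cover c" and Y: "Y = hclass M cover c"
    unfolding V.edges_F by blast
  have bc: "gtau cover b = giota c" using t b c by (simp add: X Y V.tau_F V.iota_F)
  then have bc': "gtau W (map_gallery proj b) = giota (map_gallery proj c)"
    using ov_gtau_cover[OF b] by simp
  have "map_gallery proj (gappend b c) = gappend (map_gallery proj b) (map_gallery proj c)"
    by (simp add: map_gallery_def gappend_def)
  then show "on_edges (induced_hom M W proj) (seq V.F X Y) =
      seq F (on_edges (induced_hom M W proj) X) (on_edges (induced_hom M W proj) Y)"
    using V.seq_F[OF b c bc] seq_F[OF g gallery_map_gallery[OF c] bc'] b c
      V.gallery_gappend[OF b c bc] by (simp add: X Y induced_hclass)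
qed

text \<open>On the edges issuing from a vertex, surjectivity comes from lifting galleries and
  injectivity from lifting homotopies.\<close>

lemma groupoid_covering_induced: "groupoid_covering (induced_hom M W proj) V.F F"
proof -
  let ?q = "induced_hom M W proj"
  have hom: "on_edges ?q X \<in> edges F" "iota F (on_edges ?q X) = ov (iota V.F X)"
    if "X \<in> edges V.F" for X
    using groupoid_hom_induced that by (simp_all add: groupoid_hom_def)
  have lift: "\<exists>X\<in>edges V.F. iota V.F X = x \<and> on_edges ?q X = Y"
    if x: "x \<in> verts G" and Y: "Y \<in> edges F" and xY: "iota F Y = ov x" for x Y
  proof -
    obtain c where c: "gallery M W c" "Y = hclass M W c" using Y unfolding edges_F by blast
    then have "fst c = ov x" using xY by (simp add: iota_F giota_def)
    then obtain "is" where i: "gallery M cover (x, is)" "map pe is = snd c"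
      using gallery_lift[OF x, of "snd c"] c(1) by (cases c) auto
    then have "map_gallery proj (x, is) = c"
      using \<open>fst c = ov x\<close> by (cases c) (simp add: map_gallery_def)
    then show ?thesis
      using i c by (intro bexI[of _ "hclass M cover (x, is)"])
        (simp_all add: V.iota_F V.hclass_edge giota_def induced_hclass)
  qed
  have inj: "X = X'"
    if X: "X \<in> edges V.F" and X': "X' \<in> edges V.F" and XX': "iota V.F X = iota V.F X'"
      and q: "on_edges ?q X = on_edges ?q X'" for X X'
  proof -
    obtain b where b: "gallery M cover b" "X = hclass M cover b" using X unfolding V.edges_F by blast
    obtain b' where b': "gallery M cover b'" "X' = hclass M cover b'"
      using X' unfolding V.edges_F by blast
    have e: "fst b' = fst b" using XX' b b' by (simp add: V.iota_F giota_def)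
    have "homotopic M W (map_gallery proj b) (map_gallery proj b')"
      using q b b' hclass_eq_iff[OF gallery_map_gallery[OF b(1)]] by (simp add: induced_hclass)
    \<comment> \<open>The homotopy between the projections lifts to one starting at
      \<open>b\<close>. Its other end has the start and the projection of \<open>b'\<close>, hence
      is \<open>b'\<close>.\<close>
    then obtain cs where cs: "homotopic M cover b (fst b, cs)"
      "map_gallery proj b' = (ov (fst b), map pe cs)"
      using homotopic_lift[of "fst b" "snd b" "map_gallery proj b'"] b(1)
      by (auto simp: map_gallery_def)
    then have "cs = snd b'"
      using gallery_lift_unique[of "fst b" cs "snd b'"] V.homotopic_gallery(2)[OF cs(1)] b'(1) e
      by (cases b') (auto simp: map_gallery_def)
    then have "homotopic M cover b b'" using cs(1) e by (cases b') auto
    then show ?thesis using V.hclass_eq_iff b b' by simp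
  qed
  have "bij_betw (on_edges ?q) {g \<in> edges V.F. iota V.F g = x} {h \<in> edges F. iota F h = ov x}"
    if x: "x \<in> verts G" for x
    unfolding bij_betw_def
  proof
    show "inj_on (on_edges ?q) {g \<in> edges V.F. iota V.F g = x}"
      using inj by (intro inj_onI) auto
    show "on_edges ?q ` {g \<in> edges V.F. iota V.F g = x} = {h \<in> edges F. iota F h = ov x}"
      using hom lift[OF x] by (auto simp: image_iff) metis
  qed
  \<comment> \<open>Surjectivity on stars becomes surjectivity on edges because every chamber has a
    vertex of \<open>G\<close> above it.\<close>
  moreover have "edges F \<subseteq> on_edges ?q ` edges V.F"
  proof
    fix Y assume Y: "Y \<in> edges F"
    then have "iota F Y \<in> ov ` verts G" using groupoidD(2)[OF groupoid_F] ov_surj by simp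
    then show "Y \<in> on_edges ?q ` edges V.F" using lift[OF _ Y] by force
  qed
  then have "on_edges ?q ` edges V.F = edges F" using hom(1) by blast
  ultimately show ?thesis
    using groupoid_hom_induced ov_surj by (simp add: groupoid_covering_def)
qed

section \<open>The projection as a covering of Weyl data\<close>

lemma weyl_morphism_proj: "weyl_morphism M proj cover W"
proof -
  have "chamber_system_morphism M proj cover W"
    using chamber_system_cover weyl_data ov_chamber pe_edges pe_eseq
    by (auto simp: chamber_system_morphism_def weyl_data_def simp del: split_paired_All)
  then show ?thesis
    using weyl_data weyl_data_cover suite_gallery_defining
    by (simp add: weyl_morphism_def defining_suite_cover)
qed

lemma surjective_etale_proj: "surjective_etale M proj cover W"
proof -
  have "bij_betw pe {i \<in> typed_edges M cover. eiota cover i = x}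
      {j \<in> typed_edges M W. eiota W j = ov x}" if "x \<in> verts G" for x
    \<comment> \<open>The inverse restores the starting vertex \<open>x\<close>, the only thing that
      \<open>pe\<close> forgets.\<close>
    by (rule bij_betw_byWitness[where f' = "\<lambda>(s, e). (s, x, e)"]) (use that in \<open>auto simp: typed_cover\<close>)
  then show ?thesis using ov_surj by (simp add: surjective_etale_def)
qed

lemma weyl_covering_proj: "weyl_covering M proj cover W"
  using weyl_morphism_proj surjective_etale_proj V.suite_gallery_defining
  by (simp add: weyl_covering_def defining_suite_cover)

text \<open>Both coverings have the vertices of \<open>G\<close> and the vertex map
  \<open>ov\<close> by construction, and \<open>gtau_cover\<close> is exactly the agreement of ends
  that \<open>isomorphicI\<close> demands.\<close>

lemma isomorphic_proj: "isomorphic_coverings (induced_hom M W proj) V.F \<phi> G F"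
proof (rule isomorphicI[OF groupoid_covering_induced])
  fix X assume "X \<in> edges V.F"
  then obtain b where "gallery M cover b" "X = hclass M cover b" unfolding V.edges_F by blast
  then show "endpoint (iota V.F X) (on_edges (induced_hom M W proj) X) = tau V.F X"
    by (simp add: V.iota_F V.tau_F induced_hclass gtau_cover)
qed simp_all

end

theorem theorem4p18:
  fixes M :: "'s coxeter"
    and W :: "('s, 'c, 'e) weyl_data"
    and G :: "('x, 'g) groupoid"
    and \<phi> :: "('x, 'g, 'c, ('s, 'c, 'e) gallery set) graph_map"
  assumes "two_weyl_graph M W"
    and "groupoid_covering \<phi> G (fundamental_groupoid M W)"
  shows "\<exists>(V :: ('s, 'x, 'x \<times> 'e) weyl_data) p.
           weyl_covering M p V W \<and>
           isomorphic_coverings (induced_hom M W p) (fundamental_groupoid M V) \<phi> G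
             (fundamental_groupoid M W)"
proof -
  interpret weyl_cov M W G \<phi>
    using assms by unfold_locales (simp_all add: two_weyl_graph_def pre_weyl_graph_def)
  show ?thesis using weyl_covering_proj isomorphic_proj by blast
qed

end
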